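(* Let $f\colon X\to X$ be a continuous map on a compact metric space $(X,d)$ whose topological entropy $h_{\mathrm{top}}(f)$ is finite and which preserves a Borel non-atomic probability measure $\mu$. Let $\varphi\colon X\to\mathbb{R}$ be a continuous potential. If $\mu$ is a weak-Gibbs measure for $f$ with respect to $\varphi$, then $\mu$ is an equilibrium state for $f$ and $\varphi$.
   Context: $P_{\mathrm{top}}(f,\varphi)$ denotes the usual topological pressure of $f$ and $\varphi$. For $x\in X$, $n\in\mathbb{N}$ (with $n\geq 1$) and $\varepsilon>0$, the $n$th dynamical ball is $B_n^f(x,\varepsilon)=\{y\in X:\ d(f^i(x),f^i(y))<\varepsilon\ \text{ for all } 0\le i\le n-1\}$, and the $n$th Birkhoff sum is $S_n^f\varphi(x)=\sum_{i=0}^{n-1}\varphi(f^i(x))$. A Borel probability measure $\mu$ is weak-Gibbs for $f$ with respect to $\varphi$ if there exist $\varepsilon_0>0$ and a subset $\Lambda\subset X$ with full $\mu$-measure such that, for every $0<\varepsilon<\varepsilon_0$ and every $x\in\Lambda$, there is a sequence of positive constants $(\delta_n(\varepsilon,x))_{n\in\mathbb{N}}$ satisfying $\lim_{n\to+\infty}\frac{\log\delta_n(\varepsilon,x)}{n}=0$ and, for every $n\in\mathbb{N}$, $$\delta_n(\varepsilon,x)^{-1}\le\frac{\mu(B_n^f(x,\varepsilon))}{\exp\big(-P_{\mathrm{top}}(f,\varphi)\,n+S_n^f\varphi(x)\big)}\le\delta_n(\varepsilon,x).$$ For a Borel $f$-invariant probability measure $\nu$, put $P_\nu(f,\varphi)=h_\nu(f)+\int\varphi\,d\nu$,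 where $h_\nu(f)$ is the metric entropy. A Borel $f$-invariant probability measure $\mu$ is an equilibrium state for $f$ and $\varphi$ if $P_\mu(f,\varphi)=\sup_\nu P_\nu(f,\varphi)$, where the supremum is over all Borel $f$-invariant probability measures $\nu$; by the Variational Principle this supremum equals $P_{\mathrm{top}}(f,\varphi)$. *)

theory Defs
  imports "HOL-Probability.Probability"
begin

text \<open>
  The compact metric space is the whole carrier of a type of class \<^class>\<open>metric_space\<close>; its
  compactness is a hypothesis wherever it is needed.
\<close>

definition dynamical_ball :: "('a::metric_space \<Rightarrow> 'a) \<Rightarrow> nat \<Rightarrow> 'a \<Rightarrow> real \<Rightarrow> 'a set" where
  "dynamical_ball f n x \<epsilon> = {y. \<forall>i<n. dist ((f ^^ i) x) ((f ^^ i) y) < \<epsilon>}"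

definition birkhoff_sum :: "('a \<Rightarrow> 'a) \<Rightarrow> ('a \<Rightarrow> real) \<Rightarrow> nat \<Rightarrow> 'a \<Rightarrow> real" where
  "birkhoff_sum f \<phi> n x = (\<Sum>i<n. \<phi> ((f ^^ i) x))"


subsection \<open>Topological entropy and topological pressure\<close>

definition separated :: "('a::metric_space \<Rightarrow> 'a) \<Rightarrow> nat \<Rightarrow> real \<Rightarrow> 'a set \<Rightarrow> bool" where
  "separated f n \<epsilon> E \<longleftrightarrow>
     finite E \<and> (\<forall>x\<in>E. \<forall>y\<in>E. x \<noteq> y \<longrightarrow> (\<exists>i<n. \<epsilon> < dist ((f ^^ i) x) ((f ^^ i) y)))"

text \<open>
  For continuous \<open>f\<close> on a compact space the cardinalities of the \<open>(n, \<epsilon>)\<close>-separated sets are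
  bounded, so that the maximum (and, for continuous \<open>\<phi>\<close>, the real supremum) below is a genuine
  one. The growth rates increase as \<open>\<epsilon>\<close> decreases, so that the limits at \<open>0\<close> exist in
  \<^typ>\<open>ereal\<close>.
\<close>

definition separation_number :: "('a::metric_space \<Rightarrow> 'a) \<Rightarrow> nat \<Rightarrow> real \<Rightarrow> nat" where
  "separation_number f n \<epsilon> = Max {card E | E. separated f n \<epsilon> E}"

definition topological_entropy :: "('a::metric_space \<Rightarrow> 'a) \<Rightarrow> ereal" where
  "topological_entropy f =
     Lim (at_right 0)
       (\<lambda>\<epsilon>. limsup (\<lambda>n. ereal (ln (real (separation_number f n \<epsilon>)) / real n)))"

definition partition_function ::
    "('a::metric_space \<Rightarrow> 'a) \<Rightarrow> ('a \<Rightarrow> real) \<Rightarrow> nat \<Rightarrow> real \<Rightarrow> real" where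
  "partition_function f \<phi> n \<epsilon> =
     Sup {(\<Sum>x\<in>E. exp (birkhoff_sum f \<phi> n x)) | E. separated f n \<epsilon> E}"

definition topological_pressure ::
    "('a::metric_space \<Rightarrow> 'a) \<Rightarrow> ('a \<Rightarrow> real) \<Rightarrow> ereal" where
  "topological_pressure f \<phi> =
     Lim (at_right 0)
       (\<lambda>\<epsilon>. limsup (\<lambda>n. ereal (ln (partition_function f \<phi> n \<epsilon>) / real n)))"


subsection \<open>Invariant measures and metric entropy\<close>

definition borel_prob :: "'a::topological_space measure \<Rightarrow> bool" where
  "borel_prob M \<longleftrightarrow> prob_space M \<and> sets M = sets borel"

definition invariant_prob :: "('a::topological_space \<Rightarrow> 'a) \<Rightarrow> 'a measure \<Rightarrow> bool" where
  "invariant_prob f M \<longleftrightarrow>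
     borel_prob M \<and> f \<in> borel_measurable borel \<and>
     (\<forall>A\<in>sets borel. measure M (f -` A) = measure M A)"

definition non_atomic :: "'a measure \<Rightarrow> bool" where
  "non_atomic M \<longleftrightarrow>
     (\<forall>A\<in>sets M. 0 < emeasure M A \<longrightarrow>
        (\<exists>B\<in>sets M. B \<subseteq> A \<and> 0 < emeasure M B \<and> emeasure M B < emeasure M A))"

definition finite_measurable_partition :: "'a measure \<Rightarrow> 'a set set \<Rightarrow> bool" where
  "finite_measurable_partition M P \<longleftrightarrow> finite P \<and> P \<subseteq> sets M \<and> partition_on (space M) P"

text \<open>
  The join of \<open>P\<close>, \<open>f\<^sup>-\<^sup>1 P\<close>, ..., \<open>f\<^sup>-\<^sup>(\<^sup>n\<^sup>-\<^sup>1\<^sup>) P\<close>; its cells are the nonempty sets of points with a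
  prescribed \<open>P\<close>-itinerary of length \<open>n\<close>.
\<close>

definition dynamical_join :: "('a \<Rightarrow> 'a) \<Rightarrow> nat \<Rightarrow> 'a set set \<Rightarrow> 'a set set" where
  "dynamical_join f n P =
     {(\<Inter>i<n. (f ^^ i) -` c i) | c. \<forall>i<n. c i \<in> P} - {{}}"

definition partition_entropy :: "'a measure \<Rightarrow> 'a set set \<Rightarrow> real" where
  "partition_entropy M P = - (\<Sum>A\<in>P. measure M A * ln (measure M A))"

definition entropy_wrt_partition :: "'a measure \<Rightarrow> ('a \<Rightarrow> 'a) \<Rightarrow> 'a set set \<Rightarrow> real" where
  "entropy_wrt_partition M f P = lim (\<lambda>n. partition_entropy M (dynamical_join f n P) / real n)"

definition metric_entropy :: "'a measure \<Rightarrow> ('a \<Rightarrow> 'a) \<Rightarrow> ereal" where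
  "metric_entropy M f =
     (SUP P\<in>{P. finite_measurable_partition M P}. ereal (entropy_wrt_partition M f P))"


subsection \<open>Equilibrium states and weak-Gibbs measures\<close>

definition measure_pressure :: "'a measure \<Rightarrow> ('a \<Rightarrow> 'a) \<Rightarrow> ('a \<Rightarrow> real) \<Rightarrow> ereal" where
  "measure_pressure M f \<phi> = metric_entropy M f + ereal (integral\<^sup>L M \<phi>)"

definition equilibrium_state ::
    "('a::topological_space \<Rightarrow> 'a) \<Rightarrow> ('a \<Rightarrow> real) \<Rightarrow> 'a measure \<Rightarrow> bool" where
  "equilibrium_state f \<phi> M \<longleftrightarrow>
     invariant_prob f M \<and>
     measure_pressure M f \<phi> = (SUP N\<in>{N. invariant_prob f N}. measure_pressure N f \<phi>)"

text \<open>
  The pressure enters through \<^const>\<open>real_of_ereal\<close>. This is the true value when the topological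
  entropy is finite, since the pressure of a bounded potential is then finite as well.
\<close>

definition weak_gibbs ::
    "('a::metric_space \<Rightarrow> 'a) \<Rightarrow> ('a \<Rightarrow> real) \<Rightarrow> 'a measure \<Rightarrow> bool" where
  "weak_gibbs f \<phi> M \<longleftrightarrow>
     borel_prob M \<and>
     (\<exists>\<epsilon>\<^sub>0>0. \<exists>\<Lambda>\<in>sets M. measure M \<Lambda> = 1 \<and>
       (\<forall>\<epsilon> x. 0 < \<epsilon> \<and> \<epsilon> < \<epsilon>\<^sub>0 \<and> x \<in> \<Lambda> \<longrightarrow>
         (\<exists>\<delta> :: nat \<Rightarrow> real.
            (\<forall>n\<ge>1. 0 < \<delta> n) \<and>
            (\<lambda>n. ln (\<delta> n) / real n) \<longlonglongrightarrow> 0 \<and>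
            (\<forall>n\<ge>1.
               let r = measure M (dynamical_ball f n x \<epsilon>) /
                       exp (- real_of_ereal (topological_pressure f \<phi>) * real n
                            + birkhoff_sum f \<phi> n x)
               in inverse (\<delta> n) \<le> r \<and> r \<le> \<delta> n))))"

end

theory Submission imports Defs begin

text \<open>
  For a partition into cells of diameter less than \<open>\<epsilon>\<close>, the cell of \<open>x\<close> in the \<open>n\<close>-th dynamical
  join lies in the dynamical ball of radius \<open>\<epsilon>\<close>. The upper weak-Gibbs bound therefore makes
  the lower limit of \<open>(- ln \<mu>(cell) + S\<^sub>n \<phi> x) / n\<close> at least the topological pressure almost
  everywhere, and Fatou's lemma turns this into
  \<open>P\<^sub>t\<^sub>o\<^sub>p \<le> h\<^sub>\<mu> + \<integral>\<phi>\<close>, without the Shannon--McMillan--Breiman theorem. The opposite bound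
  \<open>h\<^sub>\<nu> + \<integral>\<phi> \<le> P\<^sub>t\<^sub>o\<^sub>p\<close> for every invariant \<open>\<nu>\<close> is the easy half of the variational principle:
  the Gibbs inequality gives it up to an additive constant, which is removed by passing to
  the iterates of \<open>f\<close>. Finiteness of the entropy makes the pressure a real number.
\<close>

subsection \<open>Entropy of finite labellings\<close>

text \<open>Partitions are traded for functions with finite range: a join becomes a pair or an
  itinerary, a refinement becomes a factorization, and empty cells never arise because only attained
  values are summed. Entropy becomes an integral of a pointwise quantity, the form to which Fatou's
  lemma applies. On the Gibbs side the obstacle is that \<open>\<delta> n\<close> depends on the
  point, with no uniformity or integrability. Fatou's lemma asks only for a lower bound on the
  functions, which is at hand since information is nonnegative and \<open>\<phi>\<close> is bounded;
  and the integrals on its other side converge, by invariance and subadditivity. On the variational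
  side each time step costs a fixed amount. For the iterate \<open>f ^^ m\<close> the quantities
  compared grow by the factor \<open>m\<close> while the cost per step stays the same, so that its
  share is a constant divided by \<open>m\<close>.\<close>

definition finite_labelling :: "'a measure \<Rightarrow> ('a \<Rightarrow> 'b) \<Rightarrow> bool" where
  "finite_labelling M p \<longleftrightarrow> finite (range p) \<and> (\<forall>b. p -` {b} \<in> sets M)"

text \<open>The integrand is the information function of the labelling. Null fibres contribute
  nothing, whatever value \<open>ln\<close> takes there.\<close>

definition labelling_entropy :: "'a measure \<Rightarrow> ('a \<Rightarrow> 'b) \<Rightarrow> real" where
  "labelling_entropy M p = (\<integral>x. - ln (measure M (p -` {p x})) \<partial>M)"

text \<open>The restriction fixes the value \<open>undefined\<close> outside \<open>{..<n}\<close>.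
  Itineraries therefore lie in a finite \<open>PiE\<close> set, and their equality means agreement
  at all times below \<open>n\<close>.\<close>

definition itinerary :: "('a \<Rightarrow> 'a) \<Rightarrow> nat \<Rightarrow> ('a \<Rightarrow> 'b) \<Rightarrow> 'a \<Rightarrow> nat \<Rightarrow> 'b" where
  "itinerary f n p x = (\<lambda>i\<in>{..<n}. p ((f ^^ i) x))"

text \<open>Apply \<open>ln s \<le> s - 1\<close> to \<open>s = w i / (Z * p i)\<close> with
  \<open>Z\<close> the total weight; after multiplication by \<open>p i\<close> the right-hand sides
  add up to \<open>Z / Z - 1 = 0\<close>. Weights may vanish where \<open>p\<close> does.\<close>

lemma gibbs_inequality_sum:
  fixes p w :: "'i \<Rightarrow> real"
  assumes I: "finite I" and p: "\<And>i. i \<in> I \<Longrightarrow> 0 \<le> p i" and p1: "sum p I = 1"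
    and w: "\<And>i. i \<in> I \<Longrightarrow> 0 \<le> w i" and pw: "\<And>i. i \<in> I \<Longrightarrow> 0 < p i \<Longrightarrow> 0 < w i"
  shows "(\<Sum>i\<in>I. p i * (ln (w i) - ln (p i))) \<le> ln (sum w I)"
proof -
  define Z where "Z = sum w I"
  obtain j where j: "j \<in> I" "0 < p j"
    using p1 p by (metis less_eq_real_def sum.neutral zero_neq_one)
  have Z: "0 < Z"
    unfolding Z_def by (rule sum_pos2[OF I j(1)]) (use pw[OF j] w in auto)
  have "p i * (ln (w i) - ln (p i)) - p i * ln Z \<le> w i / Z - p i" if i: "i \<in> I" for i
  proof (cases "p i = 0")
    case True
    then show ?thesis using w[OF i] Z by simp
  next
    case False
    then have pi: "0 < p i" using p[OF i] by simp
    have wi: "0 < w i" using pw[OF i pi] .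
    have "p i * ln (w i / (Z * p i)) \<le> p i * (w i / (Z * p i) - 1)"
      using pi wi Z by (intro mult_left_mono ln_le_minus_one) auto
    moreover have "ln (w i / (Z * p i)) = ln (w i) - ln (p i) - ln Z"
      using pi wi Z by (simp add: ln_div ln_mult)
    moreover have "p i * (w i / (Z * p i) - 1) = w i / Z - p i"
      using pi Z by (simp add: field_simps)
    ultimately show ?thesis by (simp add: algebra_simps)
  qed
  then have "(\<Sum>i\<in>I. p i * (ln (w i) - ln (p i)) - p i * ln Z) \<le> (\<Sum>i\<in>I. w i / Z - p i)"
    by (rule sum_mono)
  also have "\<dots> = Z / Z - 1"
    by (simp add: sum_subtractf p1 flip: sum_divide_distrib Z_def)
  finally show ?thesis
    using Z by (simp add: sum_subtractf p1 flip: sum_distrib_right Z_def)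
qed

text \<open>Write \<open>n = q * m + r\<close> with \<open>r < m\<close>: the block part is at most
  \<open>n / m\<close> times \<open>a m\<close>, and the remainder is bounded independently of
  \<open>n\<close>. The limit is the infimum of the quotients.\<close>

lemma fekete:
  fixes a :: "nat \<Rightarrow> real"
  assumes nonneg: "\<And>n. 0 \<le> a n" and sub: "\<And>m n. a (m + n) \<le> a m + a n"
  shows "convergent (\<lambda>n. a n / real n)"
proof -
  \<comment> \<open>The index 0 is left out, because its quotient is 0 by convention.\<close>
  define L where "L = (INF n\<in>{1..}. a n / real n)"
  have bdd: "bdd_below ((\<lambda>n. a n / real n) ` {1..})"
    by (rule bdd_belowI[of _ 0]) (auto simp: nonneg)
  have low: "L \<le> a n / real n" if "1 \<le> n" for n
    unfolding L_def using that by (intro cINF_lower bdd) auto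
  have mult: "a (q * m + r) \<le> real q * a m + a r" for q m r
  proof (induction q)
    case (Suc q)
    have "a (Suc q * m + r) \<le> a m + a (q * m + r)"
      using sub[of m "q * m + r"] by (simp add: algebra_simps)
    with Suc show ?case by (simp add: algebra_simps)
  qed simp
  have "(\<lambda>n. a n / real n) \<longlonglongrightarrow> L"
  proof (rule order_tendstoI)
    fix y assume "y < L"
    then show "\<forall>\<^sub>F n in sequentially. y < a n / real n"
      using low by (intro eventually_sequentiallyI[of 1]) (meson less_le_trans)
  next
    fix y assume y: "L < y"
    have "\<exists>m\<in>{1..}. a m / real m < y"
      using y bdd cINF_less_iff[of "{1..}" "\<lambda>n. a n / real n" y] by (auto simp: L_def)
    then obtain m where m: "1 \<le> m" "a m / real m < y" by auto
    \<comment> \<open>A crude common bound for all the remainder terms \<open>a r\<close> with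
      \<open>r < m\<close>; nonnegativity lets the sum dominate each of them.\<close>
    define K where "K = (\<Sum>r<m. a r)"
    have up: "a n / real n \<le> a m / real m + K / real n" if n: "1 \<le> n" for n
    proof -
      have "a n \<le> real (n div m) * a m + a (n mod m)"
        using mult[of "n div m" m "n mod m"] by simp
      also have "a (n mod m) \<le> K"
        unfolding K_def using m by (intro member_le_sum) (auto simp: nonneg)
      also have "real (n div m) * a m \<le> (real n / real m) * a m"
        by (intro mult_right_mono nonneg of_nat_div_le_of_nat)
      finally show ?thesis using n m by (simp add: field_simps)
    qed
    have "(\<lambda>n. a m / real m + K / real n) \<longlonglongrightarrow> a m / real m + 0"
      by (intro tendsto_intros lim_const_over_n)
    then have "\<forall>\<^sub>F n in sequentially. a m / real m + K / real n < y"
      using m by (intro order_tendstoD) auto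
    then show "\<forall>\<^sub>F n in sequentially. a n / real n < y"
      using eventually_ge_at_top[of 1] by eventually_elim (use up in force)
  qed
  then show ?thesis by (auto simp: convergent_def)
qed

section \<open>Integrals of functions of the label\<close>

lemma borel_prob_space:
  assumes "borel_prob M" shows "space M = UNIV"
  using assms unfolding borel_prob_def by (metis sets_eq_imp_space_eq space_borel)

text \<open>A function of the label is a finite combination of indicators of fibres. This supplies
  measurability and integrability without any measurable structure on the type of labels.\<close>

lemma labelling_integral:
  fixes h :: "'b \<Rightarrow> real"
  assumes M: "prob_space M" "space M = UNIV" and p: "finite_labelling M p"
  shows "has_bochner_integral M (\<lambda>x. h (p x)) (\<Sum>b\<in>range p. measure M (p -` {b}) * h b)"
proof -
  interpret prob_space M by fact
  have "h (p x) = (\<Sum>b\<in>range p. indicator (p -` {b}) x * h b)" for x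
  proof -
    have "(\<Sum>b\<in>range p. indicator (p -` {b}) x * h b) = (\<Sum>b\<in>{p x}. indicator (p -` {b}) x * h b)"
      using p by (intro sum.mono_neutral_right) (auto simp: finite_labelling_def indicator_def)
    then show ?thesis by simp
  qed
  moreover have "has_bochner_integral M (\<lambda>x. \<Sum>b\<in>range p. indicator (p -` {b}) x * h b)
      (\<Sum>b\<in>range p. measure M (p -` {b}) * h b)"
    using p by (intro has_bochner_integral_sum has_bochner_integral_mult_left
        has_bochner_integral_real_indicator)
      (auto simp: finite_labelling_def less_top[symmetric])
  ultimately show ?thesis by simp
qed

lemma labelling_integrable:
  fixes h :: "'b \<Rightarrow> real"
  assumes "prob_space M" "space M = UNIV" "finite_labelling M p"
  shows "integrable M (\<lambda>x. h (p x))"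
  using labelling_integral[OF assms] by (rule integrable.intros)

lemma labelling_measure_sum:
  assumes M: "prob_space M" "space M = UNIV" and p: "finite_labelling M p"
  shows "(\<Sum>b\<in>range p. measure M (p -` {b})) = 1"
proof -
  interpret prob_space M by fact
  show ?thesis
    using labelling_integral[OF assms, of "\<lambda>_. 1"] prob_space
    by (simp add: has_bochner_integral_iff)
qed

lemma labelling_entropy_sum:
  assumes "prob_space M" "space M = UNIV" "finite_labelling M p"
  shows "labelling_entropy M p = - (\<Sum>b\<in>range p. measure M (p -` {b}) * ln (measure M (p -` {b})))"
  using labelling_integral[OF assms, of "\<lambda>b. - ln (measure M (p -` {b}))"]
  by (simp add: has_bochner_integral_iff labelling_entropy_def sum_negf)

lemma labelling_entropy_nonneg:
  assumes "prob_space M" "space M = UNIV" "finite_labelling M p"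
  shows "0 \<le> labelling_entropy M p"
proof -
  interpret prob_space M by fact
  have "- ln (measure M (p -` {p x})) \<ge> 0" for x
    by (cases "measure M (p -` {p x}) = 0") (auto simp: zero_less_measure_iff)
  then show ?thesis unfolding labelling_entropy_def by (intro Bochner_Integration.integral_nonneg) auto
qed

text \<open>The weights are the free parameter: products of marginals yield subadditivity of
  entropy, and exponentials of Birkhoff sums yield the comparison with the partition
  function.\<close>

lemma gibbs_inequality:
  assumes M: "prob_space M" "space M = UNIV" and p: "finite_labelling M p"
    and w: "\<And>b. 0 \<le> w b" and pw: "\<And>b. 0 < measure M (p -` {b}) \<Longrightarrow> 0 < w b"
  shows "labelling_entropy M p + (\<integral>x. ln (w (p x)) \<partial>M) \<le> ln (\<Sum>b\<in>range p. w b)"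
proof -
  have "(\<integral>x. ln (w (p x)) \<partial>M) = (\<Sum>b\<in>range p. measure M (p -` {b}) * ln (w b))"
    using labelling_integral[OF M p, of "\<lambda>b. ln (w b)"] by (simp add: has_bochner_integral_iff)
  moreover have "(\<Sum>b\<in>range p. measure M (p -` {b}) * (ln (w b) - ln (measure M (p -` {b}))))
      \<le> ln (\<Sum>b\<in>range p. w b)"
    using p labelling_measure_sum[OF M p]
    by (intro gibbs_inequality_sum) (auto simp: finite_labelling_def w pw)
  ultimately show ?thesis
    by (simp add: labelling_entropy_sum[OF M p] algebra_simps sum_subtractf)
qed

text \<open>Only finitely many fibres exist, so the null ones together form a null set. Off this set
  \<open>ln\<close> is monotone and turns products into sums.\<close>

lemma AE_labelling_pos:
  assumes M: "prob_space M" "space M = UNIV" and p: "finite_labelling M p"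
  shows "AE x in M. 0 < measure M (p -` {p x})"
proof -
  interpret prob_space M by fact
  have "(\<Union>b\<in>{b \<in> range p. measure M (p -` {b}) = 0}. p -` {b}) \<in> null_sets M"
    using p by (intro null_sets_UN' countable_finite)
      (auto simp: finite_labelling_def null_sets_def emeasure_eq_measure)
  then show ?thesis
    by (rule AE_I') (auto simp: zero_less_measure_iff)
qed

text \<open>The fibre of \<open>q\<close> through a point lies inside the fibre of \<open>p\<close>,
  so the information functions are ordered almost everywhere. Null fibres have to be excluded, since
  \<open>ln 0 = 0\<close> breaks monotonicity there.\<close>

lemma labelling_entropy_mono:
  assumes M: "prob_space M" "space M = UNIV" and p: "finite_labelling M p" and q: "finite_labelling M q"
    and ref: "\<And>x y. q x = q y \<Longrightarrow> p x = p y"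
  shows "labelling_entropy M p \<le> labelling_entropy M q"
proof -
  interpret prob_space M by fact
  show ?thesis unfolding labelling_entropy_def
  proof (rule integral_mono_AE)
    show "integrable M (\<lambda>x. - ln (measure M (p -` {p x})))"
      using labelling_integrable[OF M p, of "\<lambda>b. - ln (measure M (p -` {b}))"] .
    show "integrable M (\<lambda>x. - ln (measure M (q -` {q x})))"
      using labelling_integrable[OF M q, of "\<lambda>b. - ln (measure M (q -` {b}))"] .
    show "AE x in M. - ln (measure M (p -` {p x})) \<le> - ln (measure M (q -` {q x}))"
      using AE_labelling_pos[OF M q]
    proof eventually_elim
      case (elim x)
      have "measure M (q -` {q x}) \<le> measure M (p -` {p x})"
      proof (rule finite_measure_mono)
        show "q -` {q x} \<subseteq> p -` {p x}" by (auto intro: ref)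
        show "p -` {p x} \<in> sets M" using p by (simp add: finite_labelling_def)
      qed
      with elim show ?case by simp
    qed
  qed
qed

lemma labelling_entropy_cong:
  assumes "\<And>x y. p x = p y \<longleftrightarrow> q x = q y"
  shows "labelling_entropy M p = labelling_entropy M q"
proof -
  have "p -` {p x} = q -` {q x}" for x using assms by auto
  then show ?thesis by (simp add: labelling_entropy_def)
qed

lemma finite_labelling_pair:
  assumes p: "finite_labelling M p" and q: "finite_labelling M q"
  shows "finite_labelling M (\<lambda>x. (p x, q x))"
  unfolding finite_labelling_def
proof safe
  show "finite (range (\<lambda>x. (p x, q x)))"
    by (rule finite_subset[of _ "range p \<times> range q"]) (use p q in \<open>auto simp: finite_labelling_def\<close>)
  fix a b
  have "(\<lambda>x. (p x, q x)) -` {(a, b)} = p -` {a} \<inter> q -` {b}" by auto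
  then show "(\<lambda>x. (p x, q x)) -` {(a, b)} \<in> sets M"
    using p q by (auto simp: finite_labelling_def)
qed

text \<open>This is the Gibbs inequality with the product of the two marginals as weight. Only
  attained pairs are summed, so the total weight is at most 1 and its logarithm at most 0.\<close>

lemma labelling_entropy_pair:
  assumes M: "prob_space M" "space M = UNIV" and p: "finite_labelling M p" and q: "finite_labelling M q"
  shows "labelling_entropy M (\<lambda>x. (p x, q x)) \<le> labelling_entropy M p + labelling_entropy M q"
proof -
  interpret prob_space M by fact
  define w where "w = (\<lambda>(a, b). measure M (p -` {a}) * measure M (q -` {b}))"
  note pq = finite_labelling_pair[OF p q]
  have "labelling_entropy M (\<lambda>x. (p x, q x)) + (\<integral>x. ln (w (p x, q x)) \<partial>M)
      \<le> ln (\<Sum>c\<in>range (\<lambda>x. (p x, q x)). w c)"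
  proof (rule gibbs_inequality[OF M pq])
    fix c assume c: "0 < measure M ((\<lambda>x. (p x, q x)) -` {c})"
    obtain a b where ab: "c = (a, b)" by (cases c)
    have "measure M ((\<lambda>x. (p x, q x)) -` {c}) \<le> measure M (p -` {a})"
      "measure M ((\<lambda>x. (p x, q x)) -` {c}) \<le> measure M (q -` {b})"
      using p q ab by (auto intro!: finite_measure_mono simp: finite_labelling_def)
    then show "0 < w c" using c by (auto simp: w_def ab)
  qed (auto simp: w_def)
  also have "\<dots> \<le> 0"
  proof -
    have "(\<Sum>c\<in>range (\<lambda>x. (p x, q x)). w c) \<le> (\<Sum>c\<in>range p \<times> range q. w c)"
      using p q by (intro sum_mono2) (auto simp: finite_labelling_def w_def)
    also have "\<dots> = 1"
      unfolding w_def
      by (simp add: sum.cartesian_product[symmetric] labelling_measure_sum[OF M p]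
          labelling_measure_sum[OF M q] flip: sum_distrib_left)
    finally have "(\<Sum>c\<in>range (\<lambda>x. (p x, q x)). w c) \<le> 1" .
    moreover have "0 \<le> (\<Sum>c\<in>range (\<lambda>x. (p x, q x)). w c)"
      by (rule sum_nonneg) (auto simp: w_def)
    ultimately show ?thesis
      by (cases "(\<Sum>c\<in>range (\<lambda>x. (p x, q x)). w c) = 0") auto
  qed
  finally have 1: "labelling_entropy M (\<lambda>x. (p x, q x)) + (\<integral>x. ln (w (p x, q x)) \<partial>M) \<le> 0" .
  have "(\<integral>x. ln (w (p x, q x)) \<partial>M)
      = (\<integral>x. ln (measure M (p -` {p x})) + ln (measure M (q -` {q x})) \<partial>M)"
  proof (rule integral_cong_AE)
    show "AE x in M. ln (w (p x, q x)) = ln (measure M (p -` {p x})) + ln (measure M (q -` {q x}))"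
      using AE_labelling_pos[OF M p] AE_labelling_pos[OF M q]
      by eventually_elim (simp add: w_def ln_mult)
    show "(\<lambda>x. ln (w (p x, q x))) \<in> borel_measurable M"
      using labelling_integrable[OF M pq, of "\<lambda>c. ln (w c)"] by simp
    show "(\<lambda>x. ln (measure M (p -` {p x})) + ln (measure M (q -` {q x}))) \<in> borel_measurable M"
      using labelling_integrable[OF M pq, of "\<lambda>c. ln (measure M (p -` {fst c})) + ln (measure M (q -` {snd c}))"]
      by simp
  qed
  also have "\<dots> = - labelling_entropy M p - labelling_entropy M q"
    using labelling_integrable[OF M p, of "\<lambda>b. ln (measure M (p -` {b}))"]
      labelling_integrable[OF M q, of "\<lambda>b. ln (measure M (q -` {b}))"]
    by (simp add: labelling_entropy_def)
  finally show ?thesis using 1 by simp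
qed

lemma finite_labelling_compose:
  assumes p: "finite_labelling M p" and f: "f \<in> measurable M M" and M: "space M = UNIV"
  shows "finite_labelling M (\<lambda>x. p (f x))"
  unfolding finite_labelling_def
proof safe
  show "finite (range (\<lambda>x. p (f x)))"
    by (rule finite_subset[of _ "range p"]) (use p in \<open>auto simp: finite_labelling_def\<close>)
  fix b
  have "(\<lambda>x. p (f x)) -` {b} = f -` (p -` {b}) \<inter> space M" by (auto simp: M)
  then show "(\<lambda>x. p (f x)) -` {b} \<in> sets M"
    using p measurable_sets[OF f] by (simp add: finite_labelling_def)
qed

lemma measurable_funpow:
  assumes "f \<in> measurable M M" shows "f ^^ n \<in> measurable M M"
proof (induction n)
  case 0 then show ?case by (simp add: id_def)
next
  case (Suc n) then show ?case using measurable_comp[OF Suc assms] by (simp add: comp_def)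
qed

lemma itinerary_eq_iff:
  "itinerary f n p x = itinerary f n p y \<longleftrightarrow> (\<forall>i<n. p ((f ^^ i) x) = p ((f ^^ i) y))"
proof
  assume eq: "itinerary f n p x = itinerary f n p y"
  show "\<forall>i<n. p ((f ^^ i) x) = p ((f ^^ i) y)"
  proof safe
    fix i assume "i < n"
    then show "p ((f ^^ i) x) = p ((f ^^ i) y)"
      using fun_cong[OF eq, of i] by (simp add: itinerary_def)
  qed
qed (auto simp: itinerary_def intro!: restrict_ext)

lemma finite_labelling_itinerary:
  assumes p: "finite_labelling M p" and f: "f \<in> measurable M M" and M: "space M = UNIV"
  shows "finite_labelling M (itinerary f n p)"
  unfolding finite_labelling_def
proof safe
  show "finite (range (itinerary f n p))"
    by (rule finite_subset[of _ "{..<n} \<rightarrow>\<^sub>E range p"])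
      (use p in \<open>auto simp: finite_labelling_def itinerary_def intro!: finite_PiE split: if_splits\<close>)
  fix c
  \<comment> \<open>A function that is not extensional is never an itinerary; its fibre is
    empty.\<close>
  have "itinerary f n p -` {c} = (if c \<in> extensional {..<n}
      then (\<Inter>i\<in>{..<n}. (\<lambda>x. p ((f ^^ i) x)) -` {c i}) \<inter> space M else {})"
    by (auto simp: M itinerary_def intro!: extensionalityI[of _ "{..<n}"])
  also have "\<dots> \<in> sets M"
    using finite_labelling_compose[OF p measurable_funpow[OF f] M]
    by (auto simp: finite_labelling_def M intro!: sets.countable_INT'' simp flip: M)
  finally show "itinerary f n p -` {c} \<in> sets M" .
qed

subsection \<open>Invariant measures and itineraries\<close>

lemma invariant_prob_space:
  assumes "invariant_prob f M"
  shows "prob_space M" "space M = UNIV" "sets M = sets borel"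
  using assms borel_prob_space unfolding invariant_prob_def borel_prob_def by auto

lemma invariant_prob_measurable:
  assumes "invariant_prob f M" shows "f \<in> measurable M M"
  using assms invariant_prob_space(3)[OF assms] unfolding invariant_prob_def
  by (simp cong: measurable_cong_sets)

lemma invariant_prob_distr:
  assumes M: "invariant_prob f M" shows "distr M M f = M"
proof (rule measure_eqI)
  interpret prob_space M using invariant_prob_space[OF M] by simp
  fix A assume "A \<in> sets (distr M M f)"
  then have A: "A \<in> sets M" by simp
  have "measure M (f -` A) = measure M A"
    using M A invariant_prob_space(3)[OF M] by (auto simp: invariant_prob_def)
  then show "emeasure (distr M M f) A = emeasure M A"
    using A invariant_prob_measurable[OF M] invariant_prob_space(2)[OF M]
    by (simp add: emeasure_distr emeasure_eq_measure)
qed simp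

lemma invariant_prob_funpow:
  assumes M: "invariant_prob f M" shows "invariant_prob (f ^^ n) M"
proof -
  have "f ^^ n \<in> borel_measurable borel"
    using M by (auto simp: invariant_prob_def intro: measurable_funpow)
  moreover have "measure M ((f ^^ n) -` A) = measure M A" if A: "A \<in> sets borel" for A
  proof (induction n)
    case (Suc n)
    have "(f ^^ n) -` A \<in> sets borel"
      using measurable_sets[OF measurable_funpow[of f borel n] A] M
      by (simp add: invariant_prob_def)
    then have "measure M (f -` ((f ^^ n) -` A)) = measure M A"
      using M Suc by (simp add: invariant_prob_def)
    then show ?case by (simp add: vimage_comp funpow_swap1 comp_def)
  qed simp
  ultimately show ?thesis using M by (simp add: invariant_prob_def)
qed

lemma invariant_prob_integral:
  fixes h :: "'a::topological_space \<Rightarrow> real"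
  assumes M: "invariant_prob f M" and h: "h \<in> borel_measurable M"
  shows "(\<integral>x. h (f x) \<partial>M) = (\<integral>x. h x \<partial>M)"
  using integral_distr[OF invariant_prob_measurable[OF M] h] by (simp add: invariant_prob_distr[OF M])

lemma invariant_prob_integrable:
  fixes h :: "'a::topological_space \<Rightarrow> real"
  assumes M: "invariant_prob f M" and h: "integrable M h"
  shows "integrable M (\<lambda>x. h (f x))"
  using integrable_distr[OF invariant_prob_measurable[OF M], of h] h
  by (simp add: invariant_prob_distr[OF M])

lemma birkhoff_sum_integral:
  assumes M: "invariant_prob f M" and h: "integrable M h"
  shows "integrable M (birkhoff_sum f h n)" "(\<integral>x. birkhoff_sum f h n x \<partial>M) = real n * (\<integral>x. h x \<partial>M)"
proof -
  have int: "integrable M (\<lambda>x. h ((f ^^ i) x))" for i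
    by (rule invariant_prob_integrable[OF invariant_prob_funpow[OF M] h])
  then show "integrable M (birkhoff_sum f h n)"
    unfolding birkhoff_sum_def by (intro Bochner_Integration.integrable_sum)
  show "(\<integral>x. birkhoff_sum f h n x \<partial>M) = real n * (\<integral>x. h x \<partial>M)"
    unfolding birkhoff_sum_def using h int
    by (simp add: Bochner_Integration.integral_sum
        invariant_prob_integral[OF invariant_prob_funpow[OF M]])
qed

text \<open>By invariance the fibres of \<open>p\<close> and of \<open>p\<close> after
  \<open>f\<close> have equal measure, so the information function of the latter is that of
  \<open>p\<close> composed with \<open>f\<close>.\<close>

lemma labelling_entropy_invariant:
  assumes M: "invariant_prob f M" and p: "finite_labelling M p"
  shows "labelling_entropy M (\<lambda>x. p (f x)) = labelling_entropy M p"
proof -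
  note M' = invariant_prob_space[OF M]
  have "measure M ((\<lambda>x. p (f x)) -` {b}) = measure M (p -` {b})" for b
  proof -
    have "(\<lambda>x. p (f x)) -` {b} = f -` (p -` {b})" by auto
    then show ?thesis using M p M'(3) by (auto simp: invariant_prob_def finite_labelling_def)
  qed
  then have "labelling_entropy M (\<lambda>x. p (f x)) = (\<integral>x. - ln (measure M (p -` {p (f x)})) \<partial>M)"
    by (simp add: labelling_entropy_def)
  also have "\<dots> = labelling_entropy M p"
    unfolding labelling_entropy_def
    using labelling_integrable[OF M'(1,2) p, of "\<lambda>b. - ln (measure M (p -` {b}))"]
    by (intro invariant_prob_integral[OF M]) simp
  finally show ?thesis .
qed

text \<open>An itinerary of length \<open>m + n\<close> carries the same information as the pair
  formed by its first \<open>m\<close> symbols and the length-\<open>n\<close> itinerary of the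
  point reached at time \<open>m\<close>.\<close>

lemma itinerary_entropy_subadditive:
  assumes M: "invariant_prob f M" and p: "finite_labelling M p"
  shows "labelling_entropy M (itinerary f (m + n) p)
    \<le> labelling_entropy M (itinerary f m p) + labelling_entropy M (itinerary f n p)"
proof -
  note M' = invariant_prob_space[OF M] and f = invariant_prob_measurable[OF M]
  note fi = finite_labelling_itinerary[OF p f M'(2)]
  have "(\<forall>i<m+n. p ((f ^^ i) x) = p ((f ^^ i) y)) \<longleftrightarrow>
      (\<forall>i<m. p ((f ^^ i) x) = p ((f ^^ i) y)) \<and>
      (\<forall>i<n. p ((f ^^ i) ((f ^^ m) x)) = p ((f ^^ i) ((f ^^ m) y)))" (is "?L \<longleftrightarrow> ?R1 \<and> ?R2") for x y
  proof safe
    fix i assume ?L "i < n"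
    then show "p ((f ^^ i) ((f ^^ m) x)) = p ((f ^^ i) ((f ^^ m) y))"
      using \<open>?L\<close>[rule_format, of "i + m"] by (simp add: funpow_add)
  next
    fix i assume R: ?R1 ?R2 "i < m + n"
    show "p ((f ^^ i) x) = p ((f ^^ i) y)"
    proof (cases "i < m")
      case False
      then show ?thesis
        using R(2)[rule_format, of "i - m"] R(3) funpow_add[of "i - m" m f] by simp
    qed (use R in auto)
  qed auto
  then have "labelling_entropy M (itinerary f (m + n) p) =
      labelling_entropy M (\<lambda>x. (itinerary f m p x, itinerary f n p ((f ^^ m) x)))"
    by (intro labelling_entropy_cong) (simp add: itinerary_eq_iff)
  also have "\<dots> \<le> labelling_entropy M (itinerary f m p)
      + labelling_entropy M (\<lambda>x. itinerary f n p ((f ^^ m) x))"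
    by (intro labelling_entropy_pair M' fi finite_labelling_compose measurable_funpow f)
  also have "labelling_entropy M (\<lambda>x. itinerary f n p ((f ^^ m) x))
      = labelling_entropy M (itinerary f n p)"
    by (intro labelling_entropy_invariant invariant_prob_funpow M fi)
  finally show ?thesis .
qed

lemma itinerary_entropy_convergent:
  assumes M: "invariant_prob f M" and p: "finite_labelling M p"
  shows "convergent (\<lambda>n. labelling_entropy M (itinerary f n p) / real n)"
  using invariant_prob_space[OF M]
  by (intro fekete itinerary_entropy_subadditive[OF M p] labelling_entropy_nonneg
      finite_labelling_itinerary[OF p invariant_prob_measurable[OF M]])

section \<open>Finite partitions as labellings by their cells\<close>

definition partition_cell :: "'a set set \<Rightarrow> 'a \<Rightarrow> 'a set" where
  "partition_cell P x = (THE A. A \<in> P \<and> x \<in> A)"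

lemma partition_cell_eq:
  assumes "partition_on UNIV P" "A \<in> P" "x \<in> A"
  shows "partition_cell P x = A"
  unfolding partition_cell_def
proof (rule the_equality)
  fix B assume "B \<in> P \<and> x \<in> B"
  then show "B = A" using assms disjointD[OF partition_onD2[OF assms(1)], of A B] by blast
qed (use assms in auto)

lemma partition_cell:
  assumes "partition_on UNIV P"
  shows "partition_cell P x \<in> P" "x \<in> partition_cell P x"
proof -
  obtain A where "A \<in> P" "x \<in> A" using partition_onD1[OF assms] by blast
  then show "partition_cell P x \<in> P" "x \<in> partition_cell P x"
    using partition_cell_eq[OF assms] by auto
qed

lemma partition_cell_vimage:
  assumes P: "partition_on UNIV P" and A: "A \<in> P"
  shows "partition_cell P -` {A} = A"
  using partition_cell_eq[OF P A] partition_cell(2)[OF P] by auto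

lemma finite_labelling_partition_cell:
  assumes P: "finite_measurable_partition M P" and M: "space M = UNIV"
  shows "finite_labelling M (partition_cell P)"
proof -
  have P': "partition_on UNIV P" "finite P" "P \<subseteq> sets M"
    using P M by (auto simp: finite_measurable_partition_def)
  have "range (partition_cell P) \<subseteq> P" using partition_cell[OF P'(1)] by auto
  moreover have "partition_cell P -` {A} \<in> sets M" for A
  proof (cases "A \<in> P")
    case True
    then show ?thesis using P'(3) partition_cell_vimage[OF P'(1) True] by auto
  next
    case False
    then have "partition_cell P -` {A} = {}" using partition_cell(1)[OF P'(1)] by auto
    then show ?thesis by simp
  qed
  ultimately show ?thesis
    using P'(2) by (auto simp: finite_labelling_def intro: finite_subset)
qed

text \<open>Discarding the empty set from the join corresponds to indexing the fibres by attained
  itineraries only.\<close>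

lemma dynamical_join_itinerary:
  assumes P: "partition_on UNIV P"
  shows "dynamical_join f n P =
    (\<lambda>c. itinerary f n (partition_cell P) -` {c}) ` range (itinerary f n (partition_cell P))"
    (is "_ = ?R")
proof -
  let ?it = "itinerary f n (partition_cell P)"
  have cell: "(\<Inter>i<n. (f ^^ i) -` c i) = ?it -` {?it x}"
    if c: "\<forall>i<n. c i \<in> P" and x: "x \<in> (\<Inter>i<n. (f ^^ i) -` c i)" for c x
  proof -
    have c': "partition_cell P ((f ^^ i) x) = c i" if "i < n" for i
      using c x that by (intro partition_cell_eq[OF P]) auto
    have "(f ^^ i) y \<in> c i \<longleftrightarrow> partition_cell P ((f ^^ i) y) = c i" if "i < n" for i y
      using partition_cell_vimage[OF P, of "c i"] c that by blast
    then show ?thesis by (auto simp: itinerary_eq_iff c')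
  qed
  show ?thesis
  proof (intro equalityI subsetI)
    fix A assume "A \<in> dynamical_join f n P"
    then obtain c where c: "\<forall>i<n. c i \<in> P" and A: "A = (\<Inter>i<n. (f ^^ i) -` c i)" and ne: "A \<noteq> {}"
      by (auto simp: dynamical_join_def)
    from ne obtain x where x: "x \<in> A" by blast
    have "A = ?it -` {?it x}" unfolding A by (rule cell[OF c]) (use x A in blast)
    then show "A \<in> ?R" by blast
  next
    fix A assume "A \<in> ?R"
    then obtain x where A: "A = ?it -` {?it x}" by auto
    define c where "c = (\<lambda>i. partition_cell P ((f ^^ i) x))"
    have c: "\<forall>i<n. c i \<in> P" "x \<in> (\<Inter>i<n. (f ^^ i) -` c i)"
      using partition_cell[OF P] by (auto simp: c_def)
    have "A = (\<Inter>i<n. (f ^^ i) -` c i)" using cell[OF c] A by simp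
    moreover have "A \<noteq> {}" using A by auto
    ultimately show "A \<in> dynamical_join f n P" using c(1) by (auto simp: dynamical_join_def)
  qed
qed

lemma partition_entropy_fibres:
  assumes M: "prob_space M" "space M = UNIV" and p: "finite_labelling M p"
  shows "partition_entropy M ((\<lambda>c. p -` {c}) ` range p) = labelling_entropy M p"
proof -
  have "inj_on (\<lambda>c. p -` {c}) (range p)" by (auto intro!: inj_onI)
  then show ?thesis
    by (simp add: partition_entropy_def labelling_entropy_sum[OF assms] sum.reindex)
qed

text \<open>The definition through \<open>lim\<close> says something only if the sequence converges;
  subadditivity along itineraries provides this.\<close>

lemma entropy_wrt_partition_LIMSEQ:
  assumes M: "invariant_prob f M" and P: "finite_measurable_partition M P"
  shows "(\<lambda>n. labelling_entropy M (itinerary f n (partition_cell P)) / real n)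
    \<longlonglongrightarrow> entropy_wrt_partition M f P"
proof -
  note M' = invariant_prob_space[OF M] and f = invariant_prob_measurable[OF M]
  note p = finite_labelling_partition_cell[OF P M'(2)]
  have P': "partition_on UNIV P"
    using P M' by (auto simp: finite_measurable_partition_def)
  have "partition_entropy M (dynamical_join f n P) = labelling_entropy M (itinerary f n (partition_cell P))" for n
    unfolding dynamical_join_itinerary[OF P']
    by (rule partition_entropy_fibres[OF M'(1,2) finite_labelling_itinerary[OF p f M'(2)]])
  then show ?thesis
    using itinerary_entropy_convergent[OF M p]
    by (simp add: entropy_wrt_partition_def convergent_LIMSEQ_iff)
qed

lemma finite_labelling_partition:
  assumes M: "space M = UNIV" and p: "finite_labelling M p"
  obtains P where "finite_measurable_partition M P"
    "\<And>x y. partition_cell P x = partition_cell P y \<longleftrightarrow> p x = p y"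
proof
  define P where "P = (\<lambda>b. p -` {b}) ` range p"
  have P: "partition_on UNIV P"
    by (rule partition_onI) (auto simp: P_def disjnt_def)
  show "finite_measurable_partition M P"
    using P p M by (auto simp: finite_measurable_partition_def P_def finite_labelling_def)
  have "partition_cell P x = p -` {p x}" for x
    by (rule partition_cell_eq[OF P]) (auto simp: P_def)
  then show "partition_cell P x = partition_cell P y \<longleftrightarrow> p x = p y" for x y
    by auto
qed

subsection \<open>Separated sets and pressure\<close>

lemma continuous_on_funpow:
  fixes f :: "'a::topological_space \<Rightarrow> 'a"
  assumes "continuous_on UNIV f" shows "continuous_on UNIV (f ^^ n)"
proof (induction n)
  case (Suc n)
  then show ?case
    using continuous_on_compose[OF Suc continuous_on_subset[OF assms subset_UNIV]] by simp
qed (simp add: id_def)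

lemma open_dynamical_ball:
  fixes f :: "'a::metric_space \<Rightarrow> 'a"
  assumes f: "continuous_on UNIV f"
  shows "open (dynamical_ball f n x \<epsilon>)"
proof -
  have "dynamical_ball f n x \<epsilon> = (\<Inter>i<n. (f ^^ i) -` ball ((f ^^ i) x) \<epsilon>)"
    by (auto simp: dynamical_ball_def)
  moreover have "open ((f ^^ i) -` ball ((f ^^ i) x) \<epsilon>)" for i
    using continuous_on_funpow[OF f] by (intro open_vimage) auto
  ultimately show ?thesis by auto
qed

text \<open>Finitely many dynamical balls of radius \<open>\<epsilon> / 2\<close> cover the space,
  and by the triangle inequality each contains at most one point of a separated set.\<close>

lemma separated_card_bounded:
  fixes f :: "'a::metric_space \<Rightarrow> 'a"
  assumes X: "compact (UNIV :: 'a set)" and f: "continuous_on UNIV f" and \<epsilon>: "0 < \<epsilon>"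
  shows "\<exists>N. \<forall>E. separated f n \<epsilon> E \<longrightarrow> card E \<le> N"
proof -
  obtain T where T: "finite T" "UNIV \<subseteq> (\<Union>x\<in>T. dynamical_ball f n x (\<epsilon> / 2))"
  proof (rule compactE_image[OF X, of UNIV "\<lambda>x. dynamical_ball f n x (\<epsilon> / 2)"])
    show "UNIV \<subseteq> (\<Union>x. dynamical_ball f n x (\<epsilon> / 2))"
      using \<epsilon> by (auto simp: dynamical_ball_def intro!: exI)
  qed (auto intro: open_dynamical_ball f)
  have "card E \<le> card T" if E: "separated f n \<epsilon> E" for E
  proof -
    have "\<forall>x. \<exists>t\<in>T. x \<in> dynamical_ball f n t (\<epsilon> / 2)" using T(2) by blast
    then obtain t where t: "\<And>x. t x \<in> T" "\<And>x. x \<in> dynamical_ball f n (t x) (\<epsilon> / 2)" by metis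
    have "inj_on t E"
    proof (rule inj_onI, rule ccontr)
      fix x y assume xy: "x \<in> E" "y \<in> E" "t x = t y" "x \<noteq> y"
      then obtain i where i: "i < n" "\<epsilon> < dist ((f ^^ i) x) ((f ^^ i) y)"
        using E by (auto simp: separated_def)
      have "dist ((f ^^ i) (t x)) ((f ^^ i) x) < \<epsilon> / 2" "dist ((f ^^ i) (t x)) ((f ^^ i) y) < \<epsilon> / 2"
        using t(2)[of x] t(2)[of y] xy(3) i(1) by (auto simp: dynamical_ball_def)
      then have "dist ((f ^^ i) x) ((f ^^ i) y) < \<epsilon>"
        by (metis dist_commute dist_triangle_half_r)
      with i show False by simp
    qed
    then show ?thesis using t(1) T(1) by (intro card_inj_on_le[of t]) auto
  qed
  then show ?thesis by blast
qed

lemma separated_singleton: "separated f n \<epsilon> {x}"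
  by (simp add: separated_def)

lemma separated_antimono:
  assumes "separated f n \<epsilon>' E" "\<epsilon> \<le> \<epsilon>'" shows "separated f n \<epsilon> E"
  using assms unfolding separated_def by (meson le_less_trans)

lemma separation_number_ge:
  fixes f :: "'a::metric_space \<Rightarrow> 'a"
  assumes X: "compact (UNIV :: 'a set)" and f: "continuous_on UNIV f" and \<epsilon>: "0 < \<epsilon>"
    and E: "separated f n \<epsilon> E"
  shows "card E \<le> separation_number f n \<epsilon>"
  unfolding separation_number_def
proof (rule Max_ge)
  obtain N where "\<forall>E. separated f n \<epsilon> E \<longrightarrow> card E \<le> N"
    using separated_card_bounded[OF X f \<epsilon>] by blast
  then have "{card E | E. separated f n \<epsilon> E} \<subseteq> {..N}" by auto
  then show "finite {card E | E. separated f n \<epsilon> E}" by (rule finite_subset) simp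
qed (use E in blast)

lemma separation_number_attained:
  fixes f :: "'a::metric_space \<Rightarrow> 'a"
  assumes X: "compact (UNIV :: 'a set)" and f: "continuous_on UNIV f" and \<epsilon>: "0 < \<epsilon>"
  obtains E where "separated f n \<epsilon> E" "card E = separation_number f n \<epsilon>"
proof -
  obtain N where "\<forall>E. separated f n \<epsilon> E \<longrightarrow> card E \<le> N"
    using separated_card_bounded[OF X f \<epsilon>] by blast
  then have "{card E | E. separated f n \<epsilon> E} \<subseteq> {..N}" by auto
  then have "finite {card E | E. separated f n \<epsilon> E}" by (rule finite_subset) simp
  moreover have "{card E | E. separated f n \<epsilon> E} \<noteq> {}" using separated_singleton by blast
  ultimately have "separation_number f n \<epsilon> \<in> {card E | E. separated f n \<epsilon> E}"
    unfolding separation_number_def by (rule Max_in)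
  then show ?thesis using that by auto
qed

lemma separation_number_pos:
  fixes f :: "'a::metric_space \<Rightarrow> 'a"
  assumes "compact (UNIV :: 'a set)" "continuous_on UNIV f" "0 < \<epsilon>"
  shows "1 \<le> separation_number f n \<epsilon>"
  using separation_number_ge[OF assms separated_singleton] by simp

text \<open>A point far from all of a separated set of maximal cardinality could be added to it. The
  distance bound is not strict because \<open>separated\<close> asks for strict inequality.\<close>

lemma maximal_separated_spanning:
  fixes f :: "'a::metric_space \<Rightarrow> 'a"
  assumes X: "compact (UNIV :: 'a set)" and f: "continuous_on UNIV f" and \<epsilon>: "0 < \<epsilon>"
  obtains E where "separated f n \<epsilon> E"
    "\<And>x. \<exists>y\<in>E. \<forall>i<n. dist ((f ^^ i) x) ((f ^^ i) y) \<le> \<epsilon>"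
proof -
  obtain E where E: "separated f n \<epsilon> E" "card E = separation_number f n \<epsilon>"
    using separation_number_attained[OF assms] .
  have "\<exists>y\<in>E. \<forall>i<n. dist ((f ^^ i) x) ((f ^^ i) y) \<le> \<epsilon>" for x
  proof (rule ccontr)
    assume "\<not> ?thesis"
    then have far: "\<exists>i<n. \<epsilon> < dist ((f ^^ i) x) ((f ^^ i) y)" if "y \<in> E" for y
      using that by (meson not_le)
    have "x \<notin> E" using far[of x] \<epsilon> by auto
    moreover have "separated f n \<epsilon> (insert x E)"
      using E(1) far by (auto simp: separated_def dist_commute)
    then have "card (insert x E) \<le> card E"
      using separation_number_ge[OF assms] E(2) by simp
    ultimately show False using E(1) by (simp add: separated_def)
  qed
  with E(1) show ?thesis using that by blast
qed

section \<open>Bounds for partition functions and their dependence on the scale\<close>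

lemma birkhoff_sum_bound:
  assumes "\<And>x. \<bar>\<phi> x\<bar> \<le> C"
  shows "\<bar>birkhoff_sum f \<phi> n x\<bar> \<le> real n * C"
proof -
  have "\<bar>birkhoff_sum f \<phi> n x\<bar> \<le> (\<Sum>i<n. \<bar>\<phi> ((f ^^ i) x)\<bar>)"
    unfolding birkhoff_sum_def by (rule sum_abs)
  also have "\<dots> \<le> (\<Sum>i<n. C)" by (intro sum_mono assms)
  finally show ?thesis by simp
qed

lemma separated_sum_le:
  fixes f :: "'a::metric_space \<Rightarrow> 'a"
  assumes X: "compact (UNIV :: 'a set)" and f: "continuous_on UNIV f" and \<epsilon>: "0 < \<epsilon>"
    and C: "\<And>x. \<bar>\<phi> x\<bar> \<le> C" and E: "separated f n \<epsilon> E"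
  shows "(\<Sum>x\<in>E. exp (birkhoff_sum f \<phi> n x)) \<le> real (separation_number f n \<epsilon>) * exp (real n * C)"
proof -
  have "(\<Sum>x\<in>E. exp (birkhoff_sum f \<phi> n x)) \<le> (\<Sum>x\<in>E. exp (real n * C))"
    using birkhoff_sum_bound[where \<phi>=\<phi>, OF C] by (intro sum_mono) (simp add: abs_le_iff)
  also have "\<dots> \<le> real (separation_number f n \<epsilon>) * exp (real n * C)"
    using separation_number_ge[OF X f \<epsilon> E] by simp
  finally show ?thesis .
qed

lemma partition_function_bdd:
  fixes f :: "'a::metric_space \<Rightarrow> 'a"
  assumes X: "compact (UNIV :: 'a set)" and f: "continuous_on UNIV f" and \<epsilon>: "0 < \<epsilon>"
    and C: "\<And>x. \<bar>\<phi> x\<bar> \<le> C"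
  shows "bdd_above {(\<Sum>x\<in>E. exp (birkhoff_sum f \<phi> n x)) | E. separated f n \<epsilon> E}"
  using separated_sum_le[OF assms]
  by (intro bdd_aboveI[of _ "real (separation_number f n \<epsilon>) * exp (real n * C)"]) auto

lemma partition_function_ge:
  fixes f :: "'a::metric_space \<Rightarrow> 'a"
  assumes "compact (UNIV :: 'a set)" "continuous_on UNIV f" "0 < \<epsilon>" "\<And>x. \<bar>\<phi> x\<bar> \<le> C"
    and E: "separated f n \<epsilon> E"
  shows "(\<Sum>x\<in>E. exp (birkhoff_sum f \<phi> n x)) \<le> partition_function f \<phi> n \<epsilon>"
  unfolding partition_function_def using E
  by (intro cSup_upper partition_function_bdd[OF assms(1-4)]) auto

lemma partition_function_le:
  fixes f :: "'a::metric_space \<Rightarrow> 'a"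
  assumes "compact (UNIV :: 'a set)" "continuous_on UNIV f" "0 < \<epsilon>" "\<And>x. \<bar>\<phi> x\<bar> \<le> C"
  shows "partition_function f \<phi> n \<epsilon> \<le> real (separation_number f n \<epsilon>) * exp (real n * C)"
  unfolding partition_function_def using separated_singleton[of f n \<epsilon>]
  by (intro cSup_least) (blast, auto intro!: separated_sum_le[OF assms])

text \<open>A single point is a separated set. Besides bounding the pressure from below, this makes
  the partition function positive, so that logarithms can be compared.\<close>

lemma partition_function_lower:
  fixes f :: "'a::metric_space \<Rightarrow> 'a"
  assumes "compact (UNIV :: 'a set)" "continuous_on UNIV f" "0 < \<epsilon>" "\<And>x. \<bar>\<phi> x\<bar> \<le> C"
  shows "exp (- (real n * C)) \<le> partition_function f \<phi> n \<epsilon>"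
proof -
  obtain x :: 'a where True by blast
  have "exp (- (real n * C)) \<le> exp (birkhoff_sum f \<phi> n x)"
    using birkhoff_sum_bound[where \<phi>=\<phi> and f=f and n=n and x=x, OF assms(4)] by (simp add: abs_le_iff)
  also have "\<dots> \<le> partition_function f \<phi> n \<epsilon>"
    using partition_function_ge[where n=n and E="{x}", OF assms separated_singleton] by simp
  finally show ?thesis .
qed

lemma partition_function_antimono:
  fixes f :: "'a::metric_space \<Rightarrow> 'a"
  assumes "compact (UNIV :: 'a set)" "continuous_on UNIV f" "0 < \<epsilon>" "\<And>x. \<bar>\<phi> x\<bar> \<le> C" "\<epsilon> \<le> \<epsilon>'"
  shows "partition_function f \<phi> n \<epsilon>' \<le> partition_function f \<phi> n \<epsilon>"
  unfolding partition_function_def[of _ _ _ \<epsilon>'] using separated_singleton[of f n \<epsilon>']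
  by (intro cSup_least) (blast, auto intro!: partition_function_ge[OF assms(1-4)] separated_antimono[OF _ assms(5)])

lemma separation_number_antimono:
  fixes f :: "'a::metric_space \<Rightarrow> 'a"
  assumes "compact (UNIV :: 'a set)" "continuous_on UNIV f" "0 < \<epsilon>" "\<epsilon> \<le> \<epsilon>'"
  shows "separation_number f n \<epsilon>' \<le> separation_number f n \<epsilon>"
proof -
  obtain E where "separated f n \<epsilon>' E" "card E = separation_number f n \<epsilon>'"
    using separation_number_attained[OF assms(1,2)] assms(3,4) by (metis less_le_trans)
  then show ?thesis
    using separation_number_ge[OF assms(1-3)] separated_antimono[OF _ assms(4)] by metis
qed

text \<open>A function that grows as its argument decreases to 0 tends to its supremum. In the form
  of a supremum, an estimate at one single scale already bounds entropy or pressure from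
  below.\<close>

lemma Lim_at_right_antimono:
  fixes F :: "real \<Rightarrow> ereal"
  assumes anti: "\<And>x y. 0 < x \<Longrightarrow> x \<le> y \<Longrightarrow> F y \<le> F x"
  shows "Lim (at_right 0) F = (SUP x\<in>{0<..}. F x)"
proof (rule tendsto_Lim)
  show "(F \<longlongrightarrow> (SUP x\<in>{0<..}. F x)) (at_right 0)"
  proof (rule order_tendstoI)
    fix a assume "a < (SUP x\<in>{0<..}. F x)"
    then obtain y where y: "0 < y" "a < F y" by (auto simp: less_SUP_iff)
    have "\<forall>\<^sub>F x in at_right 0. 0 < x \<and> x < y"
      using y(1) by (auto simp: eventually_at_right_field)
    then show "\<forall>\<^sub>F x in at_right 0. a < F x"
      by eventually_elim (use anti y(2) in \<open>meson less_le_trans less_imp_le\<close>)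
  next
    fix a assume a: "(SUP x\<in>{0<..}. F x) < a"
    have "\<forall>\<^sub>F x in at_right (0::real). 0 < x" by (simp add: eventually_at_right_less)
    then show "\<forall>\<^sub>F x in at_right 0. F x < a"
      by eventually_elim (use a in \<open>meson SUP_upper greaterThan_iff le_less_trans\<close>)
  qed
qed simp

lemma topological_pressure_SUP:
  fixes f :: "'a::metric_space \<Rightarrow> 'a"
  assumes X: "compact (UNIV :: 'a set)" and f: "continuous_on UNIV f" and C: "\<And>x. \<bar>\<phi> x\<bar> \<le> C"
  shows "topological_pressure f \<phi> =
    (SUP \<epsilon>\<in>{0<..}. limsup (\<lambda>n. ereal (ln (partition_function f \<phi> n \<epsilon>) / real n)))"
  unfolding topological_pressure_def
proof (rule Lim_at_right_antimono, rule Limsup_mono, rule always_eventually, rule allI)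
  fix \<epsilon> \<epsilon>' :: real and n assume e: "0 < \<epsilon>" "\<epsilon> \<le> \<epsilon>'"
  have "0 < partition_function f \<phi> n \<epsilon>'"
    using partition_function_lower[where \<phi>=\<phi> and \<epsilon>=\<epsilon>' and n=n, OF X f _ C] e by (meson exp_gt_zero less_le_trans)
  then show "ereal (ln (partition_function f \<phi> n \<epsilon>') / real n)
      \<le> ereal (ln (partition_function f \<phi> n \<epsilon>) / real n)"
    using partition_function_antimono[where \<phi>=\<phi> and n=n, OF X f e(1) C e(2)]
    by (simp add: divide_right_mono)
qed

lemma topological_entropy_SUP:
  fixes f :: "'a::metric_space \<Rightarrow> 'a"
  assumes X: "compact (UNIV :: 'a set)" and f: "continuous_on UNIV f"
  shows "topological_entropy f =
    (SUP \<epsilon>\<in>{0<..}. limsup (\<lambda>n. ereal (ln (real (separation_number f n \<epsilon>)) / real n)))"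
  unfolding topological_entropy_def
proof (rule Lim_at_right_antimono, rule Limsup_mono, rule always_eventually, rule allI)
  fix \<epsilon> \<epsilon>' :: real and n assume e: "0 < \<epsilon>" "\<epsilon> \<le> \<epsilon>'"
  have "1 \<le> separation_number f n \<epsilon>'"
    using e by (intro separation_number_pos[OF X f]) auto
  then show "ereal (ln (real (separation_number f n \<epsilon>')) / real n)
      \<le> ereal (ln (real (separation_number f n \<epsilon>)) / real n)"
    using separation_number_antimono[OF X f e, of n]
    by (simp add: divide_right_mono)
qed

text \<open>Bounding every Birkhoff sum by \<open>n * C\<close> shows that the pressure exceeds the
  topological entropy by at most \<open>C\<close>; one orbit alone keeps it above
  \<open>- C\<close>.\<close>

lemma topological_pressure_finite:
  fixes f :: "'a::metric_space \<Rightarrow> 'a"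
  assumes X: "compact (UNIV :: 'a set)" and f: "continuous_on UNIV f" and C: "\<And>x. \<bar>\<phi> x\<bar> \<le> C"
    and h: "topological_entropy f < \<infinity>"
  shows "\<bar>topological_pressure f \<phi>\<bar> \<noteq> \<infinity>"
proof -
  \<comment> \<open>Takes care of \<open>n = 0\<close>, where the quotients by \<open>real n\<close>
    are 0.\<close>
  have C0: "0 \<le> C" using C[of undefined] by linarith
  have "limsup (\<lambda>n. ereal (ln (partition_function f \<phi> n \<epsilon>) / real n)) \<le> topological_entropy f + ereal C"
    if e: "0 < \<epsilon>" for \<epsilon>
  proof -
    have "ereal (ln (partition_function f \<phi> n \<epsilon>) / real n)
        \<le> ereal (ln (real (separation_number f n \<epsilon>)) / real n) + ereal C" for n
    proof -
      have s: "1 \<le> separation_number f n \<epsilon>" by (rule separation_number_pos[OF X f e])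
      have "0 < partition_function f \<phi> n \<epsilon>"
        using partition_function_lower[where \<phi>=\<phi> and n=n, OF X f e C] by (meson exp_gt_zero less_le_trans)
      then have "ln (partition_function f \<phi> n \<epsilon>) \<le> ln (real (separation_number f n \<epsilon>) * exp (real n * C))"
        using partition_function_le[where \<phi>=\<phi> and n=n, OF X f e C] by simp
      also have "\<dots> = ln (real (separation_number f n \<epsilon>)) + real n * C"
        using s by (simp add: ln_mult)
      finally have "ln (partition_function f \<phi> n \<epsilon>) / real n
          \<le> (ln (real (separation_number f n \<epsilon>)) + real n * C) / real n"
        by (simp add: divide_right_mono)
      also have "\<dots> \<le> ln (real (separation_number f n \<epsilon>)) / real n + C"
        using C0 by (cases "n = 0") (auto simp: add_divide_distrib)
      finally show ?thesis by simp
    qed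
    then have "limsup (\<lambda>n. ereal (ln (partition_function f \<phi> n \<epsilon>) / real n))
        \<le> limsup (\<lambda>n. ereal (ln (real (separation_number f n \<epsilon>)) / real n) + ereal C)"
      by (intro Limsup_mono always_eventually allI)
    also have "\<dots> = limsup (\<lambda>n. ereal (ln (real (separation_number f n \<epsilon>)) / real n)) + ereal C"
      by (rule Limsup_add_ereal_right) auto
    also have "\<dots> \<le> topological_entropy f + ereal C"
      unfolding topological_entropy_SUP[OF X f] using e by (intro add_right_mono SUP_upper) auto
    finally show ?thesis .
  qed
  then have "topological_pressure f \<phi> \<le> topological_entropy f + ereal C"
    unfolding topological_pressure_SUP[OF X f C] by (intro SUP_least) auto
  with h have 1: "topological_pressure f \<phi> < \<infinity>" by (auto simp: less_top[symmetric])
  have "ereal (- C) \<le> limsup (\<lambda>n. ereal (ln (partition_function f \<phi> n 1) / real n))"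
  proof (rule le_Limsup)
    have "- C \<le> ln (partition_function f \<phi> n 1) / real n" for n
    proof (cases "n = 0")
      case False
      have low: "exp (- (real n * C)) \<le> partition_function f \<phi> n 1"
        by (rule partition_function_lower[where \<phi>=\<phi>, OF X f _ C]) simp
      then have "0 < partition_function f \<phi> n 1" by (meson exp_gt_zero less_le_trans)
      with low have "- (real n * C) \<le> ln (partition_function f \<phi> n 1)" by (simp add: ln_ge_iff)
      then show ?thesis using False by (simp add: field_simps)
    qed (use C0 in simp)
    then show "\<forall>\<^sub>F n in sequentially. ereal (- C) \<le> ereal (ln (partition_function f \<phi> n 1) / real n)"
      by simp
  qed simp
  also have "\<dots> \<le> topological_pressure f \<phi>"
    unfolding topological_pressure_SUP[OF X f C] by (intro SUP_upper) auto
  finally have 2: "ereal (- C) \<le> topological_pressure f \<phi>" .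
  show ?thesis using 1 2 by (cases "topological_pressure f \<phi>") auto
qed

subsection \<open>The upper bound of the variational principle\<close>

text \<open>Regularity of finite Borel measures, by induction over the generated sigma-algebra.
  Approximating from both sides at once makes the claim stable under complements, which exchange the
  closed and the open set.\<close>

lemma borel_closed_open_approximation:
  fixes M :: "'a::metric_space measure"
  assumes M: "finite_measure M" "sets M = sets borel" and A: "A \<in> sets borel" and e: "0 < e"
  shows "\<exists>F U. closed F \<and> open U \<and> F \<subseteq> A \<and> A \<subseteq> U \<and> measure M (U - F) < e"
proof -
  interpret finite_measure M by fact
  have small: "\<exists>n. measure M (G n) < e" if G: "range G \<subseteq> sets borel" "decseq G"
    and lim: "measure M (\<Inter>n. G n) < e" for G :: "nat \<Rightarrow> 'a set" and e
  proof -
    have "(\<lambda>n. measure M (G n)) \<longlonglongrightarrow> measure M (\<Inter>n. G n)"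
      using G M(2) by (intro finite_Lim_measure_decseq) auto
    then have "\<forall>\<^sub>F n in sequentially. measure M (G n) < e" using lim by (rule order_tendstoD)
    then show ?thesis by (auto dest: eventually_happens)
  qed
  have "A \<in> sigma_sets UNIV {S. open S}" using A by (simp add: borel_def)
  then show ?thesis using e
  proof (induction arbitrary: e)
    case (Basic S)
    then have S: "open S" by simp
    show ?case
    \<comment> \<open>The distance to an empty complement is 0 by convention and would not detect
      interior points.\<close>
    proof (cases "S = UNIV")
      case True
      then show ?thesis using Basic by (intro exI[of _ UNIV]) auto
    next
      case False
      define F where "F n = {x. 1 / real (Suc n) \<le> infdist x (- S)}" for n
      have F: "closed (F n)" for n
        unfolding F_def by (intro closed_Collect_le continuous_intros)
      have sub: "F n \<subseteq> S" for n
      proof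
        fix x assume "x \<in> F n"
        then have "0 < infdist x (- S)"
          unfolding F_def mem_Collect_eq by (rule less_le_trans[rotated]) simp
        then show "x \<in> S" by (metis ComplI infdist_zero less_irrefl)
      qed
      have empty: "(\<Inter>n. S - F n) = {}"
      proof safe
        fix x assume x: "x \<in> (\<Inter>n. S - F n)"
        then have "x \<in> S" by auto
        then have "infdist x (- S) \<noteq> 0"
          using in_closed_iff_infdist_zero[of "- S" x] S False by auto
        then have "0 < infdist x (- S)" using infdist_nonneg[of x "- S"] by simp
        then obtain n where "1 / real (Suc n) < infdist x (- S)" using nat_approx_posE by blast
        then have "x \<in> F n" by (simp add: F_def)
        then show "x \<in> {}" using x by blast
      qed
      have dec: "decseq (\<lambda>n. S - F n)"
      proof (rule decseq_SucI)
        fix n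
        have "1 / real (Suc (Suc n)) \<le> 1 / real (Suc n)" by (simp add: field_simps)
        then show "S - F (Suc n) \<subseteq> S - F n" by (auto simp: F_def simp del: of_nat_Suc)
      qed
      have "range (\<lambda>n. S - F n) \<subseteq> sets borel" using S F by auto
      moreover have "measure M (\<Inter>n. S - F n) < e" unfolding empty using Basic.prems by simp
      ultimately obtain n where "measure M (S - F n) < e"
        using small[OF _ dec] by blast
      then show ?thesis using S F sub by blast
    qed
  next
    case Empty
    then show ?case by (intro exI[of _ "{}"]) auto
  next
    case (Compl A)
    obtain F U where FU: "closed F" "open U" "F \<subseteq> A" "A \<subseteq> U" "measure M (U - F) < e"
      using Compl.IH[OF Compl.prems] by blast
    have "- F - - U = U - F" by blast
    then have "closed (- U) \<and> open (- F) \<and> - U \<subseteq> UNIV - A \<and> UNIV - A \<subseteq> - F \<and> measure M (- F - - U) < e"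
      using FU by (metis Compl_eq_Diff_UNIV closed_Compl open_Compl Compl_subset_Compl_iff)
    then show ?case by blast
  next
    case (Union A)
    \<comment> \<open>The errors add up to \<open>e / 2\<close>, which leaves room for the strict
      inequality after a further approximation.\<close>
    have "\<exists>F U. closed F \<and> open U \<and> F \<subseteq> A i \<and> A i \<subseteq> U \<and> measure M (U - F) < e / 2 * (1 / 2) ^ Suc i" for i
      using Union.IH[of "e / 2 * (1 / 2) ^ Suc i" i] Union.prems by simp
    then obtain F U where FU: "\<And>i. closed (F i)" "\<And>i. open (U i)" "\<And>i. F i \<subseteq> A i" "\<And>i. A i \<subseteq> U i"
      "\<And>i. measure M (U i - F i) < e / 2 * (1 / 2) ^ Suc i" by metis
    have meas: "U i \<in> sets M" "F i \<in> sets M" for i using FU(1,2) M(2) by auto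
    have sums: "(\<lambda>i. e / 2 * (1 / 2) ^ Suc i) sums (e / 2 * 1)"
      by (intro sums_mult power_half_series)
    have le: "measure M (U i - F i) \<le> e / 2 * (1 / 2) ^ Suc i" for i
      using FU(5)[of i] by (rule less_imp_le)
    have summ: "summable (\<lambda>i. measure M (U i - F i))"
      by (rule summable_comparison_test'[OF sums_summable[OF sums], of 0])
        (simp only: real_norm_def abs_of_nonneg[OF measure_nonneg] le)
    \<comment> \<open>An infinite union of closed sets need not be closed, so only \<open>n\<close>
      of them are kept. The sets \<open>G n\<close> decrease, and their intersection lies in the
      union of the errors \<open>U i - F i\<close>.\<close>
    define G where "G n = (\<Union>i. U i) - (\<Union>i<n. F i)" for n
    have "measure M (\<Inter>n. G n) \<le> measure M (\<Union>i. U i - F i)"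
    proof (rule finite_measure_mono)
      show "(\<Inter>n. G n) \<subseteq> (\<Union>i. U i - F i)"
      proof
        fix x assume x: "x \<in> (\<Inter>n. G n)"
        then obtain i where i: "x \<in> U i" by (auto simp: G_def)
        have "x \<in> G (Suc i)" using x by blast
        then show "x \<in> (\<Union>i. U i - F i)" using i by (auto simp: G_def)
      qed
    qed (use meas in auto)
    also have "\<dots> \<le> (\<Sum>i. measure M (U i - F i))"
      using meas by (intro finite_measure_subadditive_countably summ) auto
    also have "\<dots> \<le> (\<Sum>i. e / 2 * (1 / 2) ^ Suc i)"
      by (intro suminf_le le summ sums_summable[OF sums])
    also have "\<dots> < e" using sums_unique[OF sums] Union.prems by simp
    finally have "measure M (\<Inter>n. G n) < e" .
    moreover have "decseq G" by (rule decseq_SucI) (auto simp: G_def)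
    moreover have "range G \<subseteq> sets borel" using meas M(2) by (auto simp: G_def)
    ultimately obtain n where n: "measure M (G n) < e" using small by blast
    have "closed (\<Union>i<n. F i)" "open (\<Union>i. U i)" using FU(1,2) by auto
    moreover have "(\<Union>i<n. F i) \<subseteq> (\<Union>i. A i)" "(\<Union>i. A i) \<subseteq> (\<Union>i. U i)" using FU(3,4) by blast+
    ultimately show ?case using n unfolding G_def by blast
  qed
qed

lemma continuous_bounded_abs:
  fixes \<phi> :: "'a::topological_space \<Rightarrow> real"
  assumes "compact (UNIV :: 'a set)" "continuous_on UNIV \<phi>"
  obtains C where "\<And>x. \<bar>\<phi> x\<bar> \<le> C"
  using compact_imp_bounded[OF compact_continuous_image[OF assms(2,1)]] that
  by (auto simp: bounded_iff)

lemma continuous_integrable: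
  fixes \<phi> :: "'a::topological_space \<Rightarrow> real"
  assumes X: "compact (UNIV :: 'a set)" and \<phi>: "continuous_on UNIV \<phi>"
    and M: "finite_measure M" "sets M = sets borel"
  shows "integrable M \<phi>"
proof -
  interpret finite_measure M by fact
  obtain C where "\<And>x. \<bar>\<phi> x\<bar> \<le> C" using continuous_bounded_abs[OF X \<phi>] by blast
  moreover have "\<phi> \<in> borel_measurable M"
    using borel_measurable_continuous_onI[OF \<phi>] M(2) by (simp cong: measurable_cong_sets)
  ultimately show ?thesis by (intro integrable_const_bound[of _ C]) auto
qed

text \<open>
  Each fibre of \<open>p\<close> is split into a closed core \<open>B b\<close> and a remainder. A small ball meets at most
  one core, and the labels in the remainder carry total weight \<open>1\<close>; so over each point of a
  spanning set the compatible itineraries have total weight at most \<open>2 ^ n\<close>. The Gibbs inequality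
  with these weights replaces the conditional entropy estimates of the classical argument.
\<close>

lemma itinerary_entropy_le_partition_function:
  fixes g :: "'a::metric_space \<Rightarrow> 'a" and p :: "'a \<Rightarrow> 'b"
  assumes X: "compact (UNIV :: 'a set)" and g: "continuous_on UNIV g"
    and \<psi>: "continuous_on UNIV \<psi>" and M: "invariant_prob g M" and p: "finite_labelling M p"
  obtains \<delta> where "0 < \<delta>" "\<And>n. labelling_entropy M (itinerary g n p) + real n * (\<integral>x. \<psi> x \<partial>M)
    \<le> ln (partition_function g \<psi> n \<delta>) + real n * (ln 2 + 2) + 1"
proof -
  note M' = invariant_prob_space[OF M] and gm = invariant_prob_measurable[OF M]
  interpret prob_space M by (rule M'(1))
  obtain C where C: "\<And>x. \<bar>\<psi> x\<bar> \<le> C" using continuous_bounded_abs[OF X \<psi>] by blast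
  define k where "k = real (card (range p))"
  have fin: "finite (range p)" using p by (simp add: finite_labelling_def)
  then have k: "1 \<le> k" by (simp add: k_def Suc_le_eq card_gt_0_iff)
  then have lnk: "0 \<le> ln k" by simp
  \<comment> \<open>Chosen so that the \<open>k\<close> remainders together have measure at most
    \<open>1 / (ln k + 1)\<close>; weighting them by \<open>1 / k\<close> then costs at most 1 per
    step on average.\<close>
  define \<eta> where "\<eta> = 1 / (k * (ln k + 1))"
  have \<eta>: "0 < \<eta>" using k lnk unfolding \<eta>_def by (intro divide_pos_pos mult_pos_pos add_nonneg_pos) auto
  have "\<exists>B. closed B \<and> B \<subseteq> p -` {b} \<and> measure M (p -` {b} - B) \<le> \<eta>" for b
  proof -
    have pb: "p -` {b} \<in> sets borel" using p M'(3) by (simp add: finite_labelling_def)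
    obtain F U where FU: "closed F" "open U" "F \<subseteq> p -` {b}" "p -` {b} \<subseteq> U" "measure M (U - F) < \<eta>"
      using borel_closed_open_approximation[OF _ M'(3) pb \<eta>] finite_measure_axioms by blast
    have "measure M (p -` {b} - F) \<le> measure M (U - F)"
      using FU M'(3) by (intro finite_measure_mono) auto
    then show ?thesis using FU by (intro exI[of _ F]) auto
  qed
  then obtain B where B: "\<And>b. closed (B b)" "\<And>b. B b \<subseteq> p -` {b}"
    "\<And>b. measure M (p -` {b} - B b) \<le> \<eta>" by metis
  have BM: "B b \<in> sets M" for b using B(1) M'(3) by simp
  have pM: "p -` {b} \<in> sets M" for b using p by (simp add: finite_labelling_def)
  define R where "R = {x. x \<notin> B (p x)}"
  have R_eq: "R = (\<Union>b\<in>range p. p -` {b} - B b)" by (auto simp: R_def)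
  have RM: "R \<in> sets M"
    unfolding R_eq by (intro sets.finite_UN fin sets.Diff BM pM)
  have "measure M R \<le> (\<Sum>b\<in>range p. measure M (p -` {b} - B b))"
    unfolding R_eq using fin BM pM by (intro finite_measure_subadditive_finite) auto
  also have "\<dots> \<le> (\<Sum>b\<in>range p. \<eta>)" by (intro sum_mono B)
  also have "\<dots> = 1 / (ln k + 1)" using k lnk by (simp add: \<eta>_def k_def)
  finally have "ln k * measure M R \<le> ln k * (1 / (ln k + 1))" by (intro mult_left_mono lnk)
  also have "\<dots> \<le> 1" using lnk by simp
  finally have R1: "ln k * measure M R \<le> 1" .
  define r where "r x = (x \<in> R, p x)" for x
  have r: "finite_labelling M r"
  proof -
    have "finite_labelling M (\<lambda>x. x \<in> R)"
      unfolding finite_labelling_def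
    proof safe
      fix b
      have "(\<lambda>x. x \<in> R) -` {b} = (if b then R else space M - R)" by (auto simp: M'(2))
      then show "(\<lambda>x. x \<in> R) -` {b} \<in> sets M" using RM by auto
    qed simp
    then show ?thesis unfolding r_def by (rule finite_labelling_pair[OF _ p])
  qed
  define t where "t = (\<lambda>(s, b :: 'b). if s then 1 / k else 1)"
  have tpos: "0 < t s" for s using k by (auto simp: t_def split: prod.splits)
  have lnt: "ln (t (r x)) = - (ln k * indicator R x)" for x
    using k by (auto simp: t_def r_def ln_div)
  obtain e where e: "0 < e" "\<And>y. \<exists>j. \<forall>z b. dist y z < e \<longrightarrow> z \<in> B b \<longrightarrow> b = j"
  proof -
    \<comment> \<open>Each member of this open cover avoids all cores but one, and \<open>x\<close>
      belongs to the member indexed by \<open>p x\<close>. The radius \<open>e\<close> is a Lebesgue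
      number of the cover.\<close>
    define \<G> where "\<G> = (\<lambda>j. - (\<Union>b\<in>range p - {j}. B b)) ` range p"
    have cover: "UNIV \<subseteq> \<Union>\<G>"
    proof
      fix x
      have "x \<in> - (\<Union>b\<in>range p - {p x}. B b)" by (auto dest!: subsetD[OF B(2)])
      then show "x \<in> \<Union>\<G>" by (auto simp: \<G>_def)
    qed
    have opn: "open G" if "G \<in> \<G>" for G
      using that fin B(1) by (auto simp: \<G>_def intro!: open_Compl closed_UN)
    obtain e where e: "0 < e" "\<forall>x\<in>UNIV. \<exists>G\<in>\<G>. ball x e \<subseteq> G"
      using Heine_Borel_lemma[OF X cover opn] by metis
    have "\<exists>j. \<forall>z b. dist y z < e \<longrightarrow> z \<in> B b \<longrightarrow> b = j" for y
    proof -
      obtain j where j: "ball y e \<subseteq> - (\<Union>b\<in>range p - {j}. B b)"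
        using e(2) unfolding \<G>_def by blast
      have "b = j" if "dist y z < e" "z \<in> B b" for z b
      proof -
        have "b \<in> range p" using that(2) B(2) by blast
        then show ?thesis using j that by (auto simp: subset_iff)
      qed
      then show ?thesis by blast
    qed
    with e(1) show ?thesis using that by blast
  qed
  obtain d where d: "0 < d" "\<And>x y. dist x y < d \<Longrightarrow> \<bar>\<psi> x - \<psi> y\<bar> < 1"
    using compact_uniformly_continuous[OF \<psi> X] unfolding uniformly_continuous_on_def
    by (metis UNIV_I dist_commute dist_real_def zero_less_one)
  \<comment> \<open>Halving makes \<open>\<delta>\<close> strictly smaller than \<open>e\<close> and
    \<open>d\<close>, as the spanning property only yields distances at most
    \<open>\<delta>\<close>.\<close>
  define \<delta> where "\<delta> = min e d / 2"
  have \<delta>: "0 < \<delta>" "\<delta> < e" "\<delta> < d" using e(1) d(1) by (auto simp: \<delta>_def min_def)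
  have "labelling_entropy M (itinerary g n p) + real n * (\<integral>x. \<psi> x \<partial>M)
    \<le> ln (partition_function g \<psi> n \<delta>) + real n * (ln 2 + 2) + 1" for n
  proof -
    obtain E where E: "separated g n \<delta> E"
      "\<And>x. \<exists>y\<in>E. \<forall>i<n. dist ((g ^^ i) x) ((g ^^ i) y) \<le> \<delta>"
      using maximal_separated_spanning[OF X g \<delta>(1)] by blast
    have finE: "finite E" using E(1) by (simp add: separated_def)
    define S where "S = birkhoff_sum g \<psi> n"
    define it where "it = itinerary g n r"
    note fit = finite_labelling_itinerary[OF r gm M'(2), of n, folded it_def]
    have Sb: "\<bar>S x\<bar> \<le> real n * C" for x
      unfolding S_def by (rule birkhoff_sum_bound) (rule C)
    \<comment> \<open>The symbols visible within \<open>\<delta>\<close> of the orbit of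
      \<open>y\<close> at time \<open>i\<close>.\<close>
    define Q where "Q y i = {s \<in> range r. \<exists>z. dist ((g ^^ i) y) z \<le> \<delta> \<and> r z = s}" for y i
    have "\<exists>y\<in>E. (\<forall>i<n. c i \<in> Q y i) \<and> (\<forall>x. it x = c \<longrightarrow> S x \<le> S y + real n + 1)"
      if c: "c \<in> range it" for c
    proof -
      \<comment> \<open>The supremum over a cell need not be attained, so a point within 1 of it is
        taken. The point of \<open>E\<close> that shadows it represents the whole itinerary.\<close>
      have "\<exists>x\<in>it -` {c}. (SUP x\<in>it -` {c}. S x) - 1 < S x"
      proof -
        have "S ` (it -` {c}) \<noteq> {}" using c by auto
        then obtain s where "s \<in> S ` (it -` {c})" "Sup (S ` (it -` {c})) - 1 < s"
          using less_cSupE[of "Sup (S ` (it -` {c})) - 1" "S ` (it -` {c})"] by auto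
        then show ?thesis by auto
      qed
      then obtain x0 where x0: "it x0 = c" "(SUP x\<in>it -` {c}. S x) - 1 < S x0" by auto
      have "bdd_above (S ` (it -` {c}))"
        using Sb by (intro bdd_aboveI[of _ "real n * C"]) (auto simp: abs_le_iff)
      then have x0': "S x \<le> S x0 + 1" if "it x = c" for x
        using cSUP_upper[of x "it -` {c}" S] that x0(2) by simp
      obtain y where y: "y \<in> E" "\<forall>i<n. dist ((g ^^ i) x0) ((g ^^ i) y) \<le> \<delta>" using E(2) by blast
      have "S x0 - S y \<le> (\<Sum>i<n. 1)"
        unfolding S_def birkhoff_sum_def sum_subtractf[symmetric]
      proof (rule sum_mono)
        fix i assume "i \<in> {..<n}"
        then have "dist ((g ^^ i) x0) ((g ^^ i) y) < d" using y(2) \<delta>(3) by (auto intro: le_less_trans)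
        then show "\<psi> ((g ^^ i) x0) - \<psi> ((g ^^ i) y) \<le> 1" using d(2) by (fastforce simp: abs_less_iff)
      qed
      then have "S x \<le> S y + real n + 1" if "it x = c" for x using x0'[OF that] by simp
      moreover have "c i \<in> Q y i" if "i < n" for i
      proof -
        have "c i = r ((g ^^ i) x0)" using x0(1) that by (auto simp: it_def itinerary_def)
        then show ?thesis using y(2) that by (auto simp: Q_def dist_commute)
      qed
      ultimately show ?thesis using y(1) by blast
    qed
    then obtain Y where Y: "\<And>c. c \<in> range it \<Longrightarrow> Y c \<in> E"
      "\<And>c i. c \<in> range it \<Longrightarrow> i < n \<Longrightarrow> c i \<in> Q (Y c) i"
      "\<And>x. S x \<le> S (Y (it x)) + real n + 1" by (metis rangeI)
    define w where "w c = exp (S (Y c)) * (\<Prod>i<n. t (c i))" for c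
    have wpos: "0 < w c" for c unfolding w_def by (intro mult_pos_pos prod_pos) (auto simp: tpos)
    \<comment> \<open>At most one core symbol contributes 1, and the at most \<open>k\<close>
      remainder symbols contribute \<open>1 / k\<close> each.\<close>
    have Q2: "(\<Sum>s\<in>Q y i. t s) \<le> 2" for y i
    proof -
      obtain j where j: "\<forall>z b. dist ((g ^^ i) y) z < e \<longrightarrow> z \<in> B b \<longrightarrow> b = j" using e(2) by blast
      have "Q y i \<subseteq> insert (False, j) (Pair True ` range p)"
      proof
        fix s assume "s \<in> Q y i"
        then obtain z where z: "dist ((g ^^ i) y) z \<le> \<delta>" "s = r z" by (auto simp: Q_def)
        show "s \<in> insert (False, j) (Pair True ` range p)"
        proof (cases "z \<in> R")
          case False
          then have "p z = j" using j le_less_trans[OF z(1) \<delta>(2)] by (auto simp: R_def)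
          then show ?thesis using z(2) False by (simp add: r_def)
        qed (auto simp: z(2) r_def)
      qed
      then have "(\<Sum>s\<in>Q y i. t s) \<le> (\<Sum>s\<in>insert (False, j) (Pair True ` range p). t s)"
        using fin tpos by (intro sum_mono2) (auto intro: less_imp_le)
      also have "\<dots> = t (False, j) + (\<Sum>b\<in>range p. t (True, b))"
        using fin by (subst sum.insert) (auto simp: sum.reindex inj_on_def)
      also have "\<dots> = 2" using k by (simp add: t_def k_def)
      finally show ?thesis .
    qed
    have finQ: "finite (Q y i)" for y i using r by (auto simp: Q_def finite_labelling_def)
    have "(\<Sum>c\<in>range it. w c) = (\<Sum>y\<in>E. \<Sum>c\<in>{c \<in> range it. Y c = y}. w c)"
      using fit finE Y(1) by (intro sum.group[symmetric]) (auto simp: finite_labelling_def)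
    also have "\<dots> \<le> (\<Sum>y\<in>E. exp (S y) * 2 ^ n)"
    proof (rule sum_mono)
      fix y assume "y \<in> E"
      have "(\<Sum>c\<in>{c \<in> range it. Y c = y}. w c)
          = (\<Sum>c\<in>{c \<in> range it. Y c = y}. exp (S y) * (\<Prod>i<n. t (c i)))"
        by (intro sum.cong) (auto simp: w_def)
      \<comment> \<open>Admitting all sequences of visible symbols, realized or not, makes the sum
        factor over the time steps.\<close>
      also have "\<dots> \<le> (\<Sum>c\<in>PiE {..<n} (Q y). exp (S y) * (\<Prod>i<n. t (c i)))"
      proof (rule sum_mono2)
        show "finite (PiE {..<n} (Q y))" using finQ by (intro finite_PiE) auto
        show "{c \<in> range it. Y c = y} \<subseteq> PiE {..<n} (Q y)"
        proof
          fix c assume c: "c \<in> {c \<in> range it. Y c = y}"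
          then obtain x where x: "c = it x" by auto
          show "c \<in> PiE {..<n} (Q y)"
          proof (rule PiE_I)
            show "c i \<in> Q y i" if "i \<in> {..<n}" for i using Y(2) c that by auto
            show "c i = undefined" if "i \<notin> {..<n}" for i
              using that unfolding x it_def itinerary_def restrict_def by (rule if_not_P)
          qed
        qed
        show "0 \<le> exp (S y) * (\<Prod>i<n. t (c i))" for c
          by (simp add: prod_nonneg less_imp_le[OF tpos])
      qed
      also have "\<dots> = exp (S y) * (\<Prod>i<n. \<Sum>s\<in>Q y i. t s)"
      proof -
        have "(\<Prod>i<n. \<Sum>s\<in>Q y i. t s) = (\<Sum>c\<in>PiE {..<n} (Q y). \<Prod>i<n. t (c i))"
          by (rule prod_sum_PiE) (rule finite_lessThan, rule finQ)
        then show ?thesis by (simp only: sum_distrib_left)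
      qed
      also have "\<dots> \<le> exp (S y) * (\<Prod>i<n. 2)"
        using Q2 by (intro mult_left_mono prod_mono) (simp_all add: sum_nonneg less_imp_le[OF tpos])
      finally show "(\<Sum>c\<in>{c \<in> range it. Y c = y}. w c) \<le> exp (S y) * 2 ^ n" by simp
    qed
    also have "\<dots> \<le> partition_function g \<psi> n \<delta> * 2 ^ n"
      using partition_function_ge[where \<phi>=\<psi>, OF X g \<delta>(1) C E(1)]
      by (simp add: S_def flip: sum_distrib_right)
    finally have sumw: "(\<Sum>c\<in>range it. w c) \<le> partition_function g \<psi> n \<delta> * 2 ^ n" .
    have Zpos: "0 < partition_function g \<psi> n \<delta>"
      using partition_function_lower[where \<phi>=\<psi> and n=n, OF X g \<delta>(1) C] by (meson exp_gt_zero less_le_trans)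
    have sumw0: "0 < (\<Sum>c\<in>range it. w c)"
      using fit by (intro sum_pos wpos) (auto simp: finite_labelling_def)
    have "labelling_entropy M it + (\<integral>x. ln (w (it x)) \<partial>M) \<le> ln (\<Sum>c\<in>range it. w c)"
      using wpos by (intro gibbs_inequality[OF M'(1,2) fit]) (auto intro: less_imp_le)
    also have "\<dots> \<le> ln (partition_function g \<psi> n \<delta> * 2 ^ n)"
      using sumw sumw0 by simp
    also have "\<dots> = ln (partition_function g \<psi> n \<delta>) + real n * ln 2"
      using Zpos by (simp add: ln_mult ln_realpow)
    finally have 1: "labelling_entropy M it + (\<integral>x. ln (w (it x)) \<partial>M)
      \<le> ln (partition_function g \<psi> n \<delta>) + real n * ln 2" .
    \<comment> \<open>The Birkhoff sum of \<open>\<xi>\<close> combines that of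
      \<open>\<psi>\<close> with the logarithms of the symbol weights, so that invariance reduces
      its integral to \<open>n\<close> times the integral of \<open>\<xi>\<close>.\<close>
    define \<xi> where "\<xi> z = \<psi> z - ln k * indicator R z" for z
    have int\<psi>: "integrable M \<psi>"
      by (rule continuous_integrable[OF X \<psi> _ M'(3)]) (rule finite_measure_axioms)
    have intR: "integrable M (\<lambda>z. ln k * indicator R z :: real)"
      using RM by (intro integrable_mult_right integrable_real_indicator) (auto simp: less_top[symmetric])
    have int\<xi>: "integrable M \<xi>"
      unfolding \<xi>_def using int\<psi> intR by (rule Bochner_Integration.integrable_diff)
    have "(\<integral>z. \<xi> z \<partial>M) = (\<integral>x. \<psi> x \<partial>M) - ln k * measure M R"
      unfolding \<xi>_def using int\<psi> intR by (simp add: M'(2))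
    then have I\<xi>: "(\<integral>x. \<psi> x \<partial>M) - 1 \<le> (\<integral>z. \<xi> z \<partial>M)" using R1 by simp
    have "birkhoff_sum g \<xi> n x - (real n + 1) \<le> ln (w (it x))" for x
    proof -
      have "ln (w (it x)) = S (Y (it x)) + (\<Sum>i<n. ln (t (it x i)))"
        by (simp add: w_def ln_mult ln_prod less_imp_neq[OF tpos, symmetric])
      also have "(\<Sum>i<n. ln (t (it x i))) = (\<Sum>i<n. - (ln k * indicator R ((g ^^ i) x)))"
        by (intro sum.cong) (auto simp: it_def itinerary_def lnt)
      finally have "ln (w (it x)) = S (Y (it x)) - (\<Sum>i<n. ln k * indicator R ((g ^^ i) x))"
        by (simp add: sum_negf)
      moreover have "birkhoff_sum g \<xi> n x = S x - (\<Sum>i<n. ln k * indicator R ((g ^^ i) x))"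
        by (simp add: birkhoff_sum_def S_def \<xi>_def sum_subtractf)
      ultimately show ?thesis using Y(3)[of x] by simp
    qed
    then have "(\<integral>x. birkhoff_sum g \<xi> n x - (real n + 1) \<partial>M) \<le> (\<integral>x. ln (w (it x)) \<partial>M)"
      using birkhoff_sum_integral(1)[OF M int\<xi>] labelling_integrable[OF M'(1,2) fit, of "\<lambda>c. ln (w c)"]
      by (intro integral_mono) auto
    then have "real n * (\<integral>z. \<xi> z \<partial>M) - (real n + 1) \<le> (\<integral>x. ln (w (it x)) \<partial>M)"
      using birkhoff_sum_integral[OF M int\<xi>, of n] by (simp add: prob_space)
    moreover have "real n * ((\<integral>x. \<psi> x \<partial>M) - 1) \<le> real n * (\<integral>z. \<xi> z \<partial>M)"
      by (intro mult_left_mono I\<xi>) simp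
    moreover have "labelling_entropy M (itinerary g n p) \<le> labelling_entropy M it"
      by (intro labelling_entropy_mono M'(1,2) fit finite_labelling_itinerary[OF p gm M'(2)])
        (auto simp: it_def itinerary_eq_iff r_def)
    \<comment> \<open>Per step, \<open>ln 2\<close> comes from the visible symbols, 1 from the
      oscillation of \<open>\<psi>\<close> and 1 from the remainder; the single additional 1 comes
      from the choice of an almost maximal point.\<close>
    ultimately show ?thesis using 1 by (simp add: algebra_simps)
  qed
  with \<delta>(1) show ?thesis using that by blast
qed

section \<open>Passage to iterates of the map\<close>

lemma birkhoff_sum_add:
  fixes f :: "'a \<Rightarrow> 'a"
  shows "birkhoff_sum f \<phi> (m + n) x = birkhoff_sum f \<phi> m x + birkhoff_sum f \<phi> n ((f ^^ m) x)"
  by (induction n) (simp_all add: birkhoff_sum_def funpow_add add.commute[of m] algebra_simps)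

lemma birkhoff_sum_iterate:
  fixes f :: "'a \<Rightarrow> 'a"
  shows "birkhoff_sum (f ^^ m) (birkhoff_sum f \<phi> m) n x = birkhoff_sum f \<phi> (n * m) x"
proof (induction n)
  case (Suc n)
  have "birkhoff_sum f \<phi> (Suc n * m) x
      = birkhoff_sum f \<phi> (n * m) x + birkhoff_sum f \<phi> m ((f ^^ (n * m)) x)"
    using birkhoff_sum_add[of f \<phi> "n * m" m x] by (simp add: add.commute)
  moreover have "((f ^^ m) ^^ n) x = (f ^^ (n * m)) x"
    by (simp add: funpow_mult mult.commute)
  ultimately show ?case using Suc by (simp add: birkhoff_sum_def)
qed (simp add: birkhoff_sum_def)

lemma separated_iterate:
  fixes f :: "'a::metric_space \<Rightarrow> 'a"
  assumes m: "0 < m" and sep: "separated (f ^^ m) n \<epsilon> E" shows "separated f (n * m) \<epsilon> E"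
  unfolding separated_def
proof (intro conjI ballI impI)
  show "finite E" using sep by (simp add: separated_def)
  fix x y assume "x \<in> E" "y \<in> E" "x \<noteq> y"
  then obtain i where i: "i < n" "\<epsilon> < dist (((f ^^ m) ^^ i) x) (((f ^^ m) ^^ i) y)"
    using sep by (auto simp: separated_def)
  show "\<exists>j<n * m. \<epsilon> < dist ((f ^^ j) x) ((f ^^ j) y)"
    using i m by (intro exI[of _ "i * m"]) (simp add: funpow_mult mult.commute)
qed

text \<open>The times \<open>i * m\<close> with \<open>i < n\<close> are among those below
  \<open>n * m\<close>, so a set separated for the iterate is separated for \<open>f\<close>, and
  the Birkhoff sums coincide.\<close>

lemma partition_function_iterate:
  fixes f :: "'a::metric_space \<Rightarrow> 'a"
  assumes "compact (UNIV :: 'a set)" "continuous_on UNIV f" "0 < \<epsilon>" "\<And>x. \<bar>\<phi> x\<bar> \<le> C" "0 < m"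
  shows "partition_function (f ^^ m) (birkhoff_sum f \<phi> m) n \<epsilon> \<le> partition_function f \<phi> (n * m) \<epsilon>"
  unfolding partition_function_def[of "f ^^ m"]
proof (rule cSup_least)
  show "{(\<Sum>x\<in>E. exp (birkhoff_sum (f ^^ m) (birkhoff_sum f \<phi> m) n x)) | E. separated (f ^^ m) n \<epsilon> E} \<noteq> {}"
    using separated_singleton[of "f ^^ m" n \<epsilon>] by blast
  fix z assume "z \<in> {(\<Sum>x\<in>E. exp (birkhoff_sum (f ^^ m) (birkhoff_sum f \<phi> m) n x)) | E. separated (f ^^ m) n \<epsilon> E}"
  then obtain E where "separated (f ^^ m) n \<epsilon> E" "z = (\<Sum>x\<in>E. exp (birkhoff_sum f \<phi> (n * m) x))"
    by (auto simp: birkhoff_sum_iterate)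
  then show "z \<le> partition_function f \<phi> (n * m) \<epsilon>"
    using partition_function_ge[where \<phi>=\<phi>, OF assms(1-4)] separated_iterate[OF assms(5)] by metis
qed

text \<open>Division with remainder matches the times \<open>l < n * m\<close> with the pairs of a
  block \<open>i < n\<close> and a position \<open>j < m\<close>.\<close>

lemma itinerary_iterate_eq_iff:
  assumes m: "0 < m"
  shows "itinerary (f ^^ m) n (itinerary f m p) x = itinerary (f ^^ m) n (itinerary f m p) y
    \<longleftrightarrow> itinerary f (n * m) p x = itinerary f (n * m) p y"
proof -
  have "(\<forall>i<n. \<forall>j<m. p ((f ^^ (j + i * m)) x) = p ((f ^^ (j + i * m)) y)) \<longleftrightarrow>
      (\<forall>l<n * m. p ((f ^^ l) x) = p ((f ^^ l) y))" (is "?L \<longleftrightarrow> ?R")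
  proof
    assume ?L
    show ?R
    proof (intro allI impI)
      fix l assume "l < n * m"
      then have "l div m < n" by (simp add: less_mult_imp_div_less)
      moreover have "l mod m < m" using m by simp
      ultimately have "p ((f ^^ (l mod m + l div m * m)) x) = p ((f ^^ (l mod m + l div m * m)) y)"
        using \<open>?L\<close> by blast
      then show "p ((f ^^ l) x) = p ((f ^^ l) y)" by simp
    qed
  next
    assume ?R
    show ?L
    proof (intro allI impI)
      fix i j assume "i < n" "j < m"
      then have "j + i * m < Suc i * m" by simp
      also have "\<dots> \<le> n * m" using \<open>i < n\<close> by (intro mult_le_mono1) simp
      finally have "j + i * m < n * m" .
      then show "p ((f ^^ (j + i * m)) x) = p ((f ^^ (j + i * m)) y)" using \<open>?R\<close> by blast
    qed
  qed
  then show ?thesis by (simp add: itinerary_eq_iff funpow_mult funpow_add mult.commute)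
qed

lemma entropy_wrt_partition_le_pressure:
  fixes f :: "'a::metric_space \<Rightarrow> 'a"
  assumes X: "compact (UNIV :: 'a set)" and f: "continuous_on UNIV f"
    and \<phi>: "continuous_on UNIV \<phi>" and M: "invariant_prob f M" and P: "finite_measurable_partition M P"
  shows "ereal (entropy_wrt_partition M f P + (\<integral>x. \<phi> x \<partial>M)) \<le> topological_pressure f \<phi>"
proof -
  note M' = invariant_prob_space[OF M] and fm = invariant_prob_measurable[OF M]
  interpret prob_space M by (rule M'(1))
  define I where "I = (\<integral>x. \<phi> x \<partial>M)"
  define h where "h = entropy_wrt_partition M f P"
  define K :: real where "K = ln 2 + 2"
  define p where "p = partition_cell P"
  have p: "finite_labelling M p" unfolding p_def by (rule finite_labelling_partition_cell[OF P M'(2)])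
  obtain C where C: "\<And>x. \<bar>\<phi> x\<bar> \<le> C" using continuous_bounded_abs[OF X \<phi>] by blast
  have int\<phi>: "integrable M \<phi>"
    by (rule continuous_integrable[OF X \<phi> _ M'(3)]) (rule finite_measure_axioms)
  define H where "H n = labelling_entropy M (itinerary f n p)" for n
  have lim: "(\<lambda>n. H n / real n) \<longlonglongrightarrow> h"
    unfolding H_def h_def p_def by (rule entropy_wrt_partition_LIMSEQ[OF M P])
  have step: "ereal (h + I - K / real m) \<le> topological_pressure f \<phi>" if m: "1 \<le> m" for m
  proof -
    let ?g = "f ^^ m" and ?\<psi> = "birkhoff_sum f \<phi> m"
    have g: "continuous_on UNIV ?g" by (rule continuous_on_funpow[OF f])
    have \<psi>: "continuous_on UNIV ?\<psi>"
      unfolding birkhoff_sum_def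
      by (intro continuous_on_sum continuous_on_compose2[OF \<phi>] continuous_on_funpow[OF f]) auto
    have q: "finite_labelling M (itinerary f m p)" by (rule finite_labelling_itinerary[OF p fm M'(2)])
    \<comment> \<open>The scale depends on \<open>m\<close>, which is harmless: the pressure is a
      supremum over scales, so each of them bounds it from below.\<close>
    obtain \<delta> where \<delta>: "0 < \<delta>" "\<And>n. labelling_entropy M (itinerary ?g n (itinerary f m p))
        + real n * (\<integral>x. ?\<psi> x \<partial>M) \<le> ln (partition_function ?g ?\<psi> n \<delta>) + real n * (ln 2 + 2) + 1"
      using itinerary_entropy_le_partition_function[OF X g \<psi> invariant_prob_funpow[OF M] q] by blast
    define Z where "Z n = partition_function f \<phi> n \<delta>" for n
    have bound: "H (n * m) / real (n * m) + I - K / real m - 1 / real (n * m) \<le> ln (Z (n * m)) / real (n * m)"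
      if n: "1 \<le> n" for n
    proof -
      have "labelling_entropy M (itinerary ?g n (itinerary f m p)) = H (n * m)"
        unfolding H_def by (rule labelling_entropy_cong) (use m in \<open>simp add: itinerary_iterate_eq_iff\<close>)
      moreover have "(\<integral>x. ?\<psi> x \<partial>M) = real m * I"
        unfolding I_def by (rule birkhoff_sum_integral(2)[OF M int\<phi>])
      moreover have "ln (partition_function ?g ?\<psi> n \<delta>) \<le> ln (Z (n * m))"
      proof -
        have "0 < partition_function ?g ?\<psi> n \<delta>"
          using partition_function_lower[where \<phi>="?\<psi>" and n=n, OF X g \<delta>(1) birkhoff_sum_bound[where \<phi>=\<phi>, OF C]]
          by (meson exp_gt_zero less_le_trans)
        then show ?thesis
          unfolding Z_def using partition_function_iterate[where \<phi>=\<phi> and n=n and m=m, OF X f \<delta>(1) C] m by simp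
      qed
      ultimately have "H (n * m) + real (n * m) * I - real n * K - 1 \<le> ln (Z (n * m))"
        using \<delta>(2)[of n] by (simp add: K_def algebra_simps)
      then have "(H (n * m) + real (n * m) * I - real n * K - 1) / real (n * m) \<le> ln (Z (n * m)) / real (n * m)"
        by (rule divide_right_mono) simp
      then show ?thesis using n m by (simp add: add_divide_distrib diff_divide_distrib)
    qed
    \<comment> \<open>Only multiples of \<open>m\<close> are controlled. This suffices, since the
      entropy quotients converge along the full sequence and a limsup along a subsequence is at most
      the full one.\<close>
    have sm: "strict_mono (\<lambda>n. n * m)" using m by (auto intro!: strict_monoI)
    have "(\<lambda>n. H (n * m) / real (n * m)) \<longlonglongrightarrow> h"
      using LIMSEQ_subseq_LIMSEQ[OF lim sm] by (simp add: comp_def)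
    moreover have "(\<lambda>n. 1 / real (n * m)) \<longlonglongrightarrow> 0"
      using LIMSEQ_subseq_LIMSEQ[OF lim_1_over_n sm] by (simp add: comp_def)
    ultimately have "(\<lambda>n. H (n * m) / real (n * m) + I - K / real m - 1 / real (n * m))
        \<longlonglongrightarrow> h + I - K / real m - 0"
      by (intro tendsto_intros)
    then have "(\<lambda>n. ereal (H (n * m) / real (n * m) + I - K / real m - 1 / real (n * m)))
        \<longlonglongrightarrow> ereal (h + I - K / real m)" by simp
    then have "ereal (h + I - K / real m)
        = limsup (\<lambda>n. ereal (H (n * m) / real (n * m) + I - K / real m - 1 / real (n * m)))"
      by (intro lim_imp_Limsup[symmetric]) auto
    also have "\<dots> \<le> limsup (\<lambda>n. ereal (ln (Z (n * m)) / real (n * m)))"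
      by (intro Limsup_mono eventually_sequentiallyI[of 1]) (use bound in auto)
    also have "\<dots> \<le> limsup (\<lambda>n. ereal (ln (Z n) / real n))"
      using limsup_subseq_mono[OF sm, of "\<lambda>n. ereal (ln (Z n) / real n)"] by (simp add: comp_def)
    also have "\<dots> \<le> topological_pressure f \<phi>"
      unfolding topological_pressure_SUP[where \<phi>=\<phi>, OF X f C] Z_def using \<delta>(1) by (intro SUP_upper) auto
    finally show ?thesis .
  qed
  have "(\<lambda>m. h + I - K / real m) \<longlonglongrightarrow> h + I - 0"
    by (intro tendsto_intros lim_const_over_n)
  then have "(\<lambda>m. ereal (h + I - K / real m)) \<longlonglongrightarrow> ereal (h + I)" by simp
  then have "ereal (h + I) \<le> topological_pressure f \<phi>"
    by (rule LIMSEQ_le_const2) (use step in blast)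
  then show ?thesis by (simp add: h_def I_def)
qed

lemma measure_pressure_le_topological_pressure:
  fixes f :: "'a::metric_space \<Rightarrow> 'a"
  assumes "compact (UNIV :: 'a set)" "continuous_on UNIV f" "continuous_on UNIV \<phi>" "invariant_prob f M"
  shows "measure_pressure M f \<phi> \<le> topological_pressure f \<phi>"
proof -
  have "metric_entropy M f \<le> topological_pressure f \<phi> - ereal (\<integral>x. \<phi> x \<partial>M)"
    unfolding metric_entropy_def
  proof (rule SUP_least)
    fix P assume "P \<in> {P. finite_measurable_partition M P}"
    then have "ereal (entropy_wrt_partition M f P) + ereal (\<integral>x. \<phi> x \<partial>M) \<le> topological_pressure f \<phi>"
      using entropy_wrt_partition_le_pressure[OF assms] by simp
    then show "ereal (entropy_wrt_partition M f P) \<le> topological_pressure f \<phi> - ereal (\<integral>x. \<phi> x \<partial>M)"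
      by (simp add: ereal_le_minus)
  qed
  then show ?thesis by (simp add: measure_pressure_def ereal_le_minus)
qed

subsection \<open>Weak-Gibbs measures\<close>

text \<open>Each point is labelled by the set of balls of a finite cover that contain it. Equal
  labels share a ball because no label is empty, and no disjoint refinement has to be built.\<close>

lemma small_labelling_exists:
  fixes M :: "'a::metric_space measure"
  assumes X: "compact (UNIV :: 'a set)" and M: "sets M = sets borel" and e: "0 < \<epsilon>"
  obtains p :: "'a \<Rightarrow> 'a set" where "finite_labelling M p" "\<And>x y. p x = p y \<Longrightarrow> dist x y < \<epsilon>"
proof -
  have cover: "(UNIV :: 'a set) \<subseteq> (\<Union>t\<in>UNIV. ball t (\<epsilon> / 2))" using e by auto
  obtain T where T: "finite T" "(UNIV :: 'a set) \<subseteq> (\<Union>t\<in>T. ball t (\<epsilon> / 2))"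
    using compactE_image[OF X _ cover] by (metis open_ball)
  define p where "p x = {t \<in> T. x \<in> ball t (\<epsilon> / 2)}" for x
  have sp: "space M = UNIV" using sets_eq_imp_space_eq[OF M] by simp
  have "finite_labelling M p"
    unfolding finite_labelling_def
  proof safe
    show "finite (range p)"
      by (rule finite_subset[of _ "Pow T"]) (use T(1) in \<open>auto simp: p_def\<close>)
    fix S
    have "p -` {S} = (if S \<subseteq> T then space M \<inter> (\<Inter>t\<in>S. ball t (\<epsilon> / 2)) - (\<Union>t\<in>T - S. ball t (\<epsilon> / 2)) else {})"
      by (auto simp: p_def sp)
    moreover have "open (\<Inter>t\<in>S. ball t (\<epsilon> / 2))" "open (\<Union>t\<in>T - S. ball t (\<epsilon> / 2))" if "S \<subseteq> T"
      using T(1) that by (auto intro!: open_INT dest: finite_subset)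
    ultimately show "p -` {S} \<in> sets M" using M sp by auto
  qed
  moreover have "dist x y < \<epsilon>" if "p x = p y" for x y
  proof -
    obtain t where "t \<in> T" "x \<in> ball t (\<epsilon> / 2)" using T(2) by blast
    then have "t \<in> p x" by (simp add: p_def)
    then have "dist t x < \<epsilon> / 2" "dist t y < \<epsilon> / 2" using that by (auto simp: p_def)
    then show ?thesis by (metis dist_commute dist_triangle_half_r)
  qed
  ultimately show ?thesis using that by blast
qed

text \<open>One radius below the threshold and one partition are enough, because metric entropy is a
  supremum over partitions. The pressure appears as the real number that \<open>weak_gibbs\<close>
  contains.\<close>

lemma weak_gibbs_partition:
  fixes f :: "'a::metric_space \<Rightarrow> 'a"
  assumes X: "compact (UNIV :: 'a set)" and f: "continuous_on UNIV f"
    and \<phi>: "continuous_on UNIV \<phi>" and M: "invariant_prob f M" and G: "weak_gibbs f \<phi> M"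
  obtains P where "finite_measurable_partition M P"
    "real_of_ereal (topological_pressure f \<phi>) \<le> entropy_wrt_partition M f P + (\<integral>x. \<phi> x \<partial>M)"
proof -
  note M' = invariant_prob_space[OF M] and fm = invariant_prob_measurable[OF M]
  interpret prob_space M by (rule M'(1))
  define Pr where "Pr = real_of_ereal (topological_pressure f \<phi>)"
  obtain \<epsilon>0 \<Lambda> where \<epsilon>0: "0 < \<epsilon>0" and \<Lambda>: "\<Lambda> \<in> sets M" "measure M \<Lambda> = 1"
    and gibbs: "\<forall>\<epsilon> x. 0 < \<epsilon> \<and> \<epsilon> < \<epsilon>0 \<and> x \<in> \<Lambda> \<longrightarrow> (\<exists>\<delta> :: nat \<Rightarrow> real. (\<forall>n\<ge>1. 0 < \<delta> n) \<and>
      (\<lambda>n. ln (\<delta> n) / real n) \<longlonglongrightarrow> 0 \<and>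
      (\<forall>n\<ge>1. let r = measure M (dynamical_ball f n x \<epsilon>) / exp (- Pr * real n + birkhoff_sum f \<phi> n x)
        in inverse (\<delta> n) \<le> r \<and> r \<le> \<delta> n))"
    using G unfolding weak_gibbs_def Pr_def[symmetric] by blast
  define \<epsilon> where "\<epsilon> = \<epsilon>0 / 2"
  have \<epsilon>: "0 < \<epsilon>" "\<epsilon> < \<epsilon>0" using \<epsilon>0 by (auto simp: \<epsilon>_def)
  obtain p0 :: "'a \<Rightarrow> 'a set" where p0: "finite_labelling M p0" "\<And>x y. p0 x = p0 y \<Longrightarrow> dist x y < \<epsilon>"
    using small_labelling_exists[OF X M'(3) \<epsilon>(1)] by blast
  obtain P where P: "finite_measurable_partition M P"
    "\<And>x y. partition_cell P x = partition_cell P y \<longleftrightarrow> p0 x = p0 y"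
    using finite_labelling_partition[OF M'(2) p0(1)] by blast
  define p where "p = partition_cell P"
  have p: "finite_labelling M p" unfolding p_def by (rule finite_labelling_partition_cell[OF P(1) M'(2)])
  have small: "dist x y < \<epsilon>" if "p x = p y" for x y using that p0(2) P(2) by (simp add: p_def)
  define it where "it n = itinerary f n p" for n
  have it: "finite_labelling M (it n)" for n
    unfolding it_def by (rule finite_labelling_itinerary[OF p fm M'(2)])
  obtain C where C: "\<And>x. \<bar>\<phi> x\<bar> \<le> C" using continuous_bounded_abs[OF X \<phi>] by blast
  have C0: "0 \<le> C" using C[of undefined] by linarith
  have int\<phi>: "integrable M \<phi>"
    by (rule continuous_integrable[OF X \<phi> _ M'(3)]) (rule finite_measure_axioms)
  define I where "I = (\<integral>x. \<phi> x \<partial>M)"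
  define h where "h = entropy_wrt_partition M f P"
  \<comment> \<open>The summand \<open>C\<close> makes every \<open>u n\<close> nonnegative, as
    Fatou's lemma in \<open>ennreal\<close> requires; the other summand keeps \<open>Pr + D\<close>
    nonnegative.\<close>
  define D where "D = C + \<bar>Pr\<bar>"
  define c where "c n x = measure M (it n -` {it n x})" for n x
  define u where "u n x = (- ln (c n x) + birkhoff_sum f \<phi> n x) / real n + D" for n x
  have u0: "0 \<le> u n x" for n x
  proof (cases "n = 0")
    case False
    have "0 \<le> - ln (c n x)"
      by (cases "c n x = 0") (auto simp: c_def zero_less_measure_iff)
    moreover have "- (real n * C) \<le> birkhoff_sum f \<phi> n x"
      using birkhoff_sum_bound[where \<phi>=\<phi> and f=f and n=n and x=x, OF C] by (simp add: abs_le_iff)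
    ultimately have "- (real n * C) / real n \<le> (- ln (c n x) + birkhoff_sum f \<phi> n x) / real n"
      by (intro divide_right_mono) auto
    then show ?thesis using False by (simp add: u_def D_def)
  qed (use C0 in \<open>simp add: u_def D_def\<close>)
  have intc: "integrable M (\<lambda>x. - ln (c n x))" for n
    unfolding c_def by (rule labelling_integrable[OF M'(1,2) it])
  note intS = birkhoff_sum_integral[OF M int\<phi>]
  have intu: "integrable M (u n)" for n
    unfolding u_def using intc intS(1) by (intro Bochner_Integration.integrable_add integrable_divide) auto
  have Iu: "(\<integral>x. u n x \<partial>M) = labelling_entropy M (it n) / real n + I + D" if "1 \<le> n" for n
  proof -
    have "(\<integral>x. u n x \<partial>M) = ((\<integral>x. - ln (c n x) \<partial>M) + (\<integral>x. birkhoff_sum f \<phi> n x \<partial>M)) / real n + D"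
      unfolding u_def using intc[of n] intS(1)[of n] by (simp add: prob_space)
    also have "\<dots> = (labelling_entropy M (it n) + real n * I) / real n + D"
      by (simp only: intS(2) labelling_entropy_def c_def I_def)
    finally show ?thesis using that by (simp add: add_divide_distrib)
  qed
  have "(\<lambda>n. labelling_entropy M (it n) / real n + I + D) \<longlonglongrightarrow> h + I + D"
    unfolding h_def it_def p_def
    by (intro tendsto_intros entropy_wrt_partition_LIMSEQ[OF M P(1)])
  then have limu: "(\<lambda>n. \<integral>x. u n x \<partial>M) \<longlonglongrightarrow> h + I + D"
    by (rule Lim_transform_eventually) (intro eventually_sequentiallyI[of 1], simp add: Iu)
  \<comment> \<open>Allows the final inequality in \<open>ennreal\<close> to be read back as one
    between real numbers.\<close>
  then have L0: "0 \<le> h + I + D"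
    by (rule LIMSEQ_le_const) (use u0 in \<open>auto intro!: Bochner_Integration.integral_nonneg\<close>)
  have "AE x in M. \<forall>n. 0 < c n x"
    unfolding AE_all_countable c_def using AE_labelling_pos[OF M'(1,2) it] by blast
  moreover have "AE x in M. x \<in> \<Lambda>" using \<Lambda>(2) by (rule AE_prob_1)
  ultimately have "AE x in M. ennreal (Pr + D) \<le> liminf (\<lambda>n. ennreal (u n x))"
  proof eventually_elim
    case (elim x)
    then obtain \<delta> :: "nat \<Rightarrow> real" where \<delta>: "\<forall>n\<ge>1. 0 < \<delta> n" "(\<lambda>n. ln (\<delta> n) / real n) \<longlonglongrightarrow> 0"
      "\<forall>n\<ge>1. measure M (dynamical_ball f n x \<epsilon>) / exp (- Pr * real n + birkhoff_sum f \<phi> n x) \<le> \<delta> n"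
      using gibbs[rule_format, of \<epsilon> x] \<epsilon> by (auto simp: Let_def)
    have le: "Pr - ln (\<delta> n) / real n + D \<le> u n x" if n: "1 \<le> n" for n
    proof -
      have "it n -` {it n x} \<subseteq> dynamical_ball f n x \<epsilon>"
        using small by (auto simp: it_def itinerary_eq_iff dynamical_ball_def)
      then have "c n x \<le> measure M (dynamical_ball f n x \<epsilon>)"
        unfolding c_def using open_dynamical_ball[OF f] M'(3) by (intro finite_measure_mono) auto
      also have "\<dots> \<le> \<delta> n * exp (- Pr * real n + birkhoff_sum f \<phi> n x)"
        using \<delta>(3) n by (simp add: divide_le_eq)
      \<comment> \<open>Taking logarithms preserves the inequality because almost every point has
        all its cells of positive measure.\<close>
      finally have "ln (c n x) \<le> ln (\<delta> n * exp (- Pr * real n + birkhoff_sum f \<phi> n x))"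
        using elim(1) by (subst ln_le_cancel_iff) (auto intro: less_le_trans)
      also have "\<dots> = ln (\<delta> n) + (- Pr * real n + birkhoff_sum f \<phi> n x)"
        using less_imp_neq[OF \<delta>(1)[rule_format, OF n]] by (simp add: ln_mult)
      finally have "(Pr * real n - ln (\<delta> n)) / real n \<le> (- ln (c n x) + birkhoff_sum f \<phi> n x) / real n"
        by (intro divide_right_mono) auto
      then show ?thesis using n by (simp add: u_def diff_divide_distrib)
    qed
    have "(\<lambda>n. Pr - ln (\<delta> n) / real n + D) \<longlonglongrightarrow> Pr - 0 + D"
      by (intro tendsto_intros \<delta>(2))
    then have "(\<lambda>n. ennreal (Pr - ln (\<delta> n) / real n + D)) \<longlonglongrightarrow> ennreal (Pr + D)"
      by (intro tendsto_ennrealI) simp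
    then have "ennreal (Pr + D) = liminf (\<lambda>n. ennreal (Pr - ln (\<delta> n) / real n + D))"
      by (intro lim_imp_Liminf[symmetric]) auto
    also have "\<dots> \<le> liminf (\<lambda>n. ennreal (u n x))"
      by (intro Liminf_mono eventually_sequentiallyI[of 1] ennreal_leI le)
    finally show ?case .
  qed
  then have "(\<integral>\<^sup>+x. ennreal (Pr + D) \<partial>M) \<le> (\<integral>\<^sup>+x. liminf (\<lambda>n. ennreal (u n x)) \<partial>M)"
    by (rule nn_integral_mono_AE)
  also have "\<dots> \<le> liminf (\<lambda>n. \<integral>\<^sup>+x. ennreal (u n x) \<partial>M)"
    using intu by (intro nn_integral_liminf) auto
  also have "\<dots> = liminf (\<lambda>n. ennreal (\<integral>x. u n x \<partial>M))"
    using u0 by (simp add: nn_integral_eq_integral[OF intu])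
  also have "\<dots> = ennreal (h + I + D)"
    by (intro lim_imp_Liminf tendsto_ennrealI limu) simp
  finally have "ennreal (Pr + D) \<le> ennreal (h + I + D)"
    by (simp add: emeasure_space_1)
  then have "Pr \<le> h + I" using L0 by (simp add: ennreal_le_iff)
  then show ?thesis using that[OF P(1)] by (simp add: Pr_def h_def I_def)
qed

theorem corollary1:
  fixes f :: "'a::metric_space \<Rightarrow> 'a" and \<phi> :: "'a \<Rightarrow> real" and \<mu> :: "'a measure"
  assumes "compact (UNIV :: 'a set)"
    and "continuous_on UNIV f"
    and "topological_entropy f < \<infinity>"
    and "invariant_prob f \<mu>"
    and "non_atomic \<mu>"
    and "continuous_on UNIV \<phi>"
    and "weak_gibbs f \<phi> \<mu>"
  shows "equilibrium_state f \<phi> \<mu>"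
proof -
  note X = assms(1) and f = assms(2) and \<mu> = assms(4) and \<phi> = assms(6)
  obtain C where C: "\<And>x. \<bar>\<phi> x\<bar> \<le> C" using continuous_bounded_abs[OF X \<phi>] by blast
  have fin: "\<bar>topological_pressure f \<phi>\<bar> \<noteq> \<infinity>"
    by (rule topological_pressure_finite[where \<phi>=\<phi>, OF X f C assms(3)])
  obtain P where P: "finite_measurable_partition \<mu> P"
    "real_of_ereal (topological_pressure f \<phi>) \<le> entropy_wrt_partition \<mu> f P + (\<integral>x. \<phi> x \<partial>\<mu>)"
    using weak_gibbs_partition[OF X f \<phi> \<mu> assms(7)] by blast
  \<comment> \<open>Finiteness is essential here, as \<open>real_of_ereal\<close> sends infinite
    values to 0.\<close>
  have "topological_pressure f \<phi> \<le> ereal (entropy_wrt_partition \<mu> f P) + ereal (\<integral>x. \<phi> x \<partial>\<mu>)"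
    using P(2) fin by (cases "topological_pressure f \<phi>") auto
  also have "\<dots> \<le> measure_pressure \<mu> f \<phi>"
    unfolding measure_pressure_def metric_entropy_def using P(1) by (intro add_right_mono SUP_upper) auto
  finally have lower: "topological_pressure f \<phi> \<le> measure_pressure \<mu> f \<phi>" .
  \<comment> \<open>Since \<open>\<mu>\<close> is itself a competitor, its pressure, the supremum
    and the topological pressure are squeezed together.\<close>
  have "(SUP N\<in>{N. invariant_prob f N}. measure_pressure N f \<phi>) \<le> topological_pressure f \<phi>"
    using measure_pressure_le_topological_pressure[OF X f \<phi>] by (intro SUP_least) auto
  moreover have "measure_pressure \<mu> f \<phi> \<le> (SUP N\<in>{N. invariant_prob f N}. measure_pressure N f \<phi>)"
    using \<mu> by (intro SUP_upper) auto
  ultimately show ?thesis using \<mu> lower by (auto simp: equilibrium_state_def intro: antisym)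
qed

end
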